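(* Let $B>0$. Consider the directed exponential network model with interaction effect on nodes $\{1,\dots,n\}$: for each pair $i<j\le n$ the pair $Y_{ij}=(a_{ij},a_{ji})\in\{0,1\}^2$ is drawn, independently over pairs, from $$ g(a_{ij},a_{ji};\alpha_i,\beta_i,\alpha_j,\beta_j,\rho)=\frac{\exp\{(\alpha_i+\beta_j)a_{ij}+(\beta_i+\alpha_j)a_{ji}+\rho\, a_{ij}a_{ji}\}}{Z(\alpha_i,\beta_i,\alpha_j,\beta_j,\rho)}, $$ with $Z$ the normalizing constant, at true parameters $\alpha^*_i,\beta^*_i,\rho^*$, all in $[-B,B]$, with $\alpha^*_1=0$. Let $(\hat{\boldsymbol\alpha},\hat{\boldsymbol\beta},\hat\rho)$ be the maximum likelihood estimator normalized by $\hat\alpha_1=0$. Then $$ \|\hat{\boldsymbol\alpha}-\boldsymbol\alpha^*\|_\infty+\|\hat{\boldsymbol\beta}-\boldsymbol\beta^*\|_\infty=O_p\big(n^{-1/8}\sqrt{\log n}\big). $$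
   Context: $a_{ij}=1$ indicates a directed edge from $i$ to $j$. The parameters $(\boldsymbol\alpha,\boldsymbol\beta,\rho)$ and $(\boldsymbol\alpha-x,\boldsymbol\beta+x,\rho)$ define the same model, so the normalization $\alpha_1=0$ is imposed. The MLE maximizes $\sum_{i<j}\log g(a_{ij},a_{ji};\alpha_i,\beta_i,\alpha_j,\beta_j,\rho)$ over the parameter space with all coordinates in $[-B,B]$ and $\alpha_1=0$. *)

theory Defs
  imports Complex_Main
begin

definition ind :: "bool \<Rightarrow> real" where
  "ind b = (if b then 1 else 0)"

text \<open>Unnormalized weight of the dyad outcome (x,y) = (a_ij, a_ji).\<close>
definition dyad_weight :: "bool \<Rightarrow> bool \<Rightarrow> real \<Rightarrow> real \<Rightarrow> real \<Rightarrow> real \<Rightarrow> real \<Rightarrow> real" where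
  "dyad_weight x y ai bi aj bj r =
     exp ((ai + bj) * ind x + (bi + aj) * ind y + r * ind x * ind y)"

definition dyad_Z :: "real \<Rightarrow> real \<Rightarrow> real \<Rightarrow> real \<Rightarrow> real \<Rightarrow> real" where
  "dyad_Z ai bi aj bj r = (\<Sum>x\<in>UNIV. \<Sum>y\<in>UNIV. dyad_weight x y ai bi aj bj r)"

definition dyad_g :: "bool \<Rightarrow> bool \<Rightarrow> real \<Rightarrow> real \<Rightarrow> real \<Rightarrow> real \<Rightarrow> real \<Rightarrow> real" where
  "dyad_g x y ai bi aj bj r = dyad_weight x y ai bi aj bj r / dyad_Z ai bi aj bj r"

text \<open>Directed graphs on nodes {1..n} (no self loops): a i j = True means edge i -> j.\<close>
definition graphs :: "nat \<Rightarrow> (nat \<Rightarrow> nat \<Rightarrow> bool) set" where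
  "graphs n = {a. \<forall>i j. a i j \<longrightarrow> i \<in> {1..n} \<and> j \<in> {1..n} \<and> i \<noteq> j}"

definition pairs :: "nat \<Rightarrow> (nat \<times> nat) set" where
  "pairs n = {(i, j). i \<in> {1..n} \<and> j \<in> {1..n} \<and> i < j}"

definition graph_prob :: "nat \<Rightarrow> (nat \<Rightarrow> real) \<Rightarrow> (nat \<Rightarrow> real) \<Rightarrow> real \<Rightarrow> (nat \<Rightarrow> nat \<Rightarrow> bool) \<Rightarrow> real" where
  "graph_prob n \<alpha> \<beta> \<rho> a =
     (\<Prod>(i, j)\<in>pairs n. dyad_g (a i j) (a j i) (\<alpha> i) (\<beta> i) (\<alpha> j) (\<beta> j) \<rho>)"

definition model_prob :: "nat \<Rightarrow> (nat \<Rightarrow> real) \<Rightarrow> (nat \<Rightarrow> real) \<Rightarrow> real \<Rightarrow> (nat \<Rightarrow> nat \<Rightarrow> bool) set \<Rightarrow> real" where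
  "model_prob n \<alpha> \<beta> \<rho> S = (\<Sum>a\<in>graphs n \<inter> S. graph_prob n \<alpha> \<beta> \<rho> a)"

definition loglik :: "nat \<Rightarrow> (nat \<Rightarrow> nat \<Rightarrow> bool) \<Rightarrow> (nat \<Rightarrow> real) \<Rightarrow> (nat \<Rightarrow> real) \<Rightarrow> real \<Rightarrow> real" where
  "loglik n a \<alpha> \<beta> \<rho> =
     (\<Sum>(i, j)\<in>pairs n. ln (dyad_g (a i j) (a j i) (\<alpha> i) (\<beta> i) (\<alpha> j) (\<beta> j) \<rho>))"

definition param_space :: "nat \<Rightarrow> real \<Rightarrow> ((nat \<Rightarrow> real) \<times> (nat \<Rightarrow> real) \<times> real) set" where
  "param_space n B = {(\<alpha>, \<beta>, \<rho>).
      (\<forall>i\<in>{1..n}. \<bar>\<alpha> i\<bar> \<le> B \<and> \<bar>\<beta> i\<bar> \<le> B) \<and>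
      (\<forall>i. i \<notin> {1..n} \<longrightarrow> \<alpha> i = 0 \<and> \<beta> i = 0) \<and>
      \<bar>\<rho>\<bar> \<le> B \<and> \<alpha> 1 = 0}"

definition sup_dist :: "nat \<Rightarrow> (nat \<Rightarrow> real) \<Rightarrow> (nat \<Rightarrow> real) \<Rightarrow> real" where
  "sup_dist n x y = Max ((\<lambda>i. \<bar>x i - y i\<bar>) ` {1..n})"

end

theory Submission
  imports Defs "HOL-Library.FuncSet" "HOL-Analysis.Convex" "HOL-Real_Asymp.Real_Asymp"
begin

text \<open>The negative log-likelihood of a dyad is uniformly convex in its natural parameters
  \<open>(\<alpha>\<^sub>i + \<beta>\<^sub>j, \<beta>\<^sub>i + \<alpha>\<^sub>j, \<rho>)\<close>. Suppose that all row, column and reciprocity sums of the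
  centred edge variables are at most \<open>t\<close>. Comparing the estimator with its midpoint to the truth
  gives \<open>\<Sum>\<^sub>i (u\<^sub>i\<^sup>2 + v\<^sub>i\<^sup>2) = O(t)\<close>, where \<open>u\<^sub>i\<close> and \<open>v\<^sub>i\<close> are the errors of \<open>\<alpha>\<^sub>i\<close> and \<open>\<beta>\<^sub>i\<close> up to
  a common shift \<open>(-c, c)\<close>. The truth shifted by \<open>(-c, c)\<close> need not lie in the box, so \<open>c\<close> is
  bounded separately: call a node bad if \<open>|u\<^sub>i|\<close> or \<open>|v\<^sub>i|\<close> exceeds \<open>|c|/2\<close>; shifting the good nodes
  by \<open>(c/2, -c/2)\<close> and moving the bad ones (node 1 among them, by its normalization) half-way to
  the truth is feasible and would increase the likelihood unless \<open>c = O(\<surd>(t/n))\<close>. Moving a single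
  node half-way to the truth then bounds its own error by \<open>O(\<surd>(t/n))\<close>. A Chernoff bound allows
  \<open>t = n\<^bsup>3/4\<^esup> log n\<close>.\<close>

section \<open>A single dyad\<close>

text \<open>The dyad law as a three-parameter exponential family: \<open>x\<close>,
  \<open>y\<close>, \<open>r\<close> stand for the natural parameters
  \<open>\<alpha> i + \<beta> j\<close>, \<open>\<beta> i + \<alpha> j\<close>,
  \<open>\<rho>\<close>.\<close>

definition dyad_q :: "bool \<Rightarrow> bool \<Rightarrow> real \<Rightarrow> real \<Rightarrow> real \<Rightarrow> real" where
  "dyad_q a b x y r = exp (x * ind a + y * ind b + r * ind a * ind b) /
     (1 + exp x + exp y + exp (x + y + r))"

text \<open>With \<open>mean_rec\<close>, the gradient of the log-partition function. The mean of
  the second coordinate gets no name of its own; it is \<open>mean_out y x r\<close>, by symmetry of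
  the family.\<close>

definition mean_out :: "real \<Rightarrow> real \<Rightarrow> real \<Rightarrow> real" where
  "mean_out x y r = dyad_q True True x y r + dyad_q True False x y r"

definition mean_rec :: "real \<Rightarrow> real \<Rightarrow> real \<Rightarrow> real" where
  "mean_rec x y r = dyad_q True True x y r"

lemma dyad_g_eq: "dyad_g a b ai bi aj bj r = dyad_q a b (ai + bj) (bi + aj) r"
  by (simp add: dyad_g_def dyad_q_def dyad_weight_def dyad_Z_def UNIV_bool ind_def algebra_simps)

lemma dyad_Z_pos: "0 < 1 + exp x + exp y + exp (x + y + r :: real)"
  by (intro add_pos_pos) auto

lemma dyad_q_pos: "0 < dyad_q a b x y r"
  by (simp add: dyad_q_def dyad_Z_pos)

lemma dyad_q_sum:
  "dyad_q True True x y r + dyad_q True False x y r + dyad_q False True x y r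
    + dyad_q False False x y r = 1"
  using dyad_Z_pos[of x y r]
  by (simp add: dyad_q_def ind_def add_divide_distrib[symmetric] add_ac)

lemma dyad_q_le_1: "dyad_q a b x y r \<le> 1"
  using dyad_q_sum[of x y r] dyad_q_pos[of True True x y r] dyad_q_pos[of True False x y r]
    dyad_q_pos[of False True x y r] dyad_q_pos[of False False x y r]
  by (cases a; cases b; simp only: simp_thms; linarith)

lemma mean_out_swap: "mean_out y x r = dyad_q True True x y r + dyad_q False True x y r"
  by (simp add: mean_out_def dyad_q_def ind_def add_ac)

lemma mean_rec_swap: "mean_rec y x r = mean_rec x y r"
  by (simp add: mean_rec_def dyad_q_def ind_def add_ac)

lemma ln_dyad_q:
  "ln (dyad_q a b x y r) = x * ind a + y * ind b + r * ind a * ind b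
     - ln (1 + exp x + exp y + exp (x + y + r))"
  using dyad_Z_pos[of x y r] by (simp add: dyad_q_def ln_div)

text \<open>This is \<open>ln z \<le> z - 1\<close> at \<open>z = q / p\<close>, multiplied by
  \<open>p\<close>. Summed over all outcomes of two probability distributions, the right-hand side
  cancels.\<close>

lemma ln_ratio_le:
  fixes p q :: real
  assumes "0 < p" "0 < q"
  shows "p * (ln q - ln p) \<le> q - p"
proof -
  have "ln q - ln p = ln (q / p)" using assms by (simp add: ln_div)
  also have "\<dots> \<le> q / p - 1" using assms by (intro ln_le_minus_one) simp
  finally have "p * (ln q - ln p) \<le> p * (q / p - 1)"
    using assms by (intro mult_left_mono) auto
  also have "\<dots> = q - p" using assms by (simp add: field_simps)
  finally show ?thesis .
qed

text \<open>Nonnegativity of the relative entropy is the tangent inequality for the log-partition function.\<close>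

lemma ln_dyad_q_tangent:
  "ln (dyad_q a b x2 y2 r2) - ln (dyad_q a b x1 y1 r1) \<le>
     (ind a - mean_out x1 y1 r1) * (x2 - x1) + (ind b - mean_out y1 x1 r1) * (y2 - y1)
     + (ind a * ind b - mean_rec x1 y1 r1) * (r2 - r1)"
proof -
  define L where "L = ln (1 + exp x2 + exp y2 + exp (x2 + y2 + r2)) - ln (1 + exp x1 + exp y1 + exp (x1 + y1 + r1))"
  define Q where "Q a b = dyad_q a b x1 y1 r1" for a b
  define D where "D a b = (x2 - x1) * ind a + (y2 - y1) * ind b + (r2 - r1) * ind a * ind b - L" for a b
  have D: "ln (dyad_q a b x2 y2 r2) - ln (dyad_q a b x1 y1 r1) = D a b" for a b
    by (simp add: ln_dyad_q D_def L_def algebra_simps)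
  have "Q a b * D a b \<le> dyad_q a b x2 y2 r2 - Q a b" for a b
    unfolding D[symmetric] Q_def by (rule ln_ratio_le) (rule dyad_q_pos)+
  from this[of True True] this[of True False] this[of False True] this[of False False]
  have "Q True True * D True True + Q True False * D True False + Q False True * D False True
      + Q False False * D False False \<le> 0"
    using dyad_q_sum[of x2 y2 r2] dyad_q_sum[of x1 y1 r1] unfolding Q_def by linarith
  moreover have "Q True True * D True True + Q True False * D True False + Q False True * D False True
      + Q False False * D False False
     = (Q True True + Q True False) * (x2 - x1) + (Q True True + Q False True) * (y2 - y1)
      + Q True True * (r2 - r1) - (Q True True + Q True False + Q False True + Q False False) * L"
    by (simp add: D_def ind_def algebra_simps)
  ultimately have "mean_out x1 y1 r1 * (x2 - x1) + mean_out y1 x1 r1 * (y2 - y1)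
      + mean_rec x1 y1 r1 * (r2 - r1) \<le> L"
    using dyad_q_sum[of x1 y1 r1] unfolding mean_out_swap[of y1] mean_out_def[of x1] mean_rec_def Q_def
    by simp
  then show ?thesis unfolding D by (simp add: D_def algebra_simps)
qed

text \<open>On \<open>[m, \<infinity>)\<close> the logarithm has slope at most \<open>1 / m\<close>,
  so \<open>\<bar>p - q\<bar>\<close> is at least \<open>m\<close> times the difference of the
  logarithms, which has the same sign.\<close>

lemma ln_diff_le_diff:
  fixes m p q :: real
  assumes "0 < m" "m \<le> p" "m \<le> q"
  shows "m * (ln p - ln q)\<^sup>2 \<le> (p - q) * (ln p - ln q)"
proof -
  have *: "m * (ln p - ln q)\<^sup>2 \<le> (p - q) * (ln p - ln q)" if "m \<le> q" "q \<le> p" for p q :: real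
  proof -
    have pos: "0 < q" "0 < p" using that assms by auto
    then have ge: "0 \<le> ln p - ln q" using that by simp
    have "m * (ln p - ln q) \<le> q * (ln p - ln q)"
      using that ge by (intro mult_right_mono) auto
    also have "\<dots> \<le> p - q" by (rule ln_ratio_le) (use pos in auto)
    finally show ?thesis
      using mult_right_mono[OF _ ge] by (simp add: power2_eq_square mult.assoc[symmetric])
  qed
  show ?thesis
    using *[of q p] *[of p q] assms by (cases "q \<le> p") (auto simp: power2_commute algebra_simps)
qed

text \<open>The numerator is at least \<open>exp (- (3 * K))\<close>, and each of the four summands
  of the denominator is at most \<open>exp (3 * K)\<close>.\<close>

lemma dyad_q_lower:
  assumes "\<bar>x\<bar> \<le> K" "\<bar>y\<bar> \<le> K" "\<bar>r\<bar> \<le> K"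
  shows "exp (- (6 * K)) / 4 \<le> dyad_q a b x y r"
proof -
  have "exp x \<le> exp (3 * K)" "exp y \<le> exp (3 * K)" "exp (x + y + r) \<le> exp (3 * K)" "1 \<le> exp (3 * K)"
    using assms by auto
  then have Z: "1 + exp x + exp y + exp (x + y + r) \<le> 4 * exp (3 * K)" by linarith
  have N: "exp (- (3 * K)) \<le> exp (x * ind a + y * ind b + r * ind a * ind b)"
    using assms by (auto simp: ind_def)
  have "exp (- (6 * K)) / 4 = exp (- (3 * K)) / (4 * exp (3 * K))"
    by (simp add: exp_minus field_simps flip: exp_add)
  also have "\<dots> \<le> dyad_q a b x y r"
    unfolding dyad_q_def using N Z dyad_Z_pos[of x y r] by (intro frac_le) auto
  finally show ?thesis .
qed

text \<open>The left-hand side is the symmetrized relative entropy of the two dyad distributions.\<close>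

lemma mean_strongly_monotone:
  assumes "\<bar>x1\<bar> \<le> K" "\<bar>y1\<bar> \<le> K" "\<bar>r1\<bar> \<le> K" "\<bar>x2\<bar> \<le> K" "\<bar>y2\<bar> \<le> K" "\<bar>r2\<bar> \<le> K"
  shows "(mean_out x2 y2 r2 - mean_out x1 y1 r1) * (x2 - x1)
     + (mean_out y2 x2 r2 - mean_out y1 x1 r1) * (y2 - y1)
     + (mean_rec x2 y2 r2 - mean_rec x1 y1 r1) * (r2 - r1)
     \<ge> exp (- (6 * K)) / 32 * ((x2 - x1)\<^sup>2 + (y2 - y1)\<^sup>2 + (r2 - r1)\<^sup>2)" (is "?lhs \<ge> _")
proof -
  define L where "L = ln (1 + exp x2 + exp y2 + exp (x2 + y2 + r2)) - ln (1 + exp x1 + exp y1 + exp (x1 + y1 + r1))"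
  define D where "D a b = (x2 - x1) * ind a + (y2 - y1) * ind b + (r2 - r1) * ind a * ind b - L" for a b
  define E where "E a b = dyad_q a b x2 y2 r2 - dyad_q a b x1 y1 r1" for a b
  define m where "m = exp (- (6 * K)) / 4"
  have D: "ln (dyad_q a b x2 y2 r2) - ln (dyad_q a b x1 y1 r1) = D a b" for a b
    by (simp add: ln_dyad_q D_def L_def algebra_simps)
  have "m * (D a b)\<^sup>2 \<le> E a b * D a b" for a b
    unfolding D[symmetric] E_def
    using dyad_q_lower[OF assms(1-3), of a b] dyad_q_lower[OF assms(4-6), of a b]
    by (intro ln_diff_le_diff) (simp_all only: m_def, simp)
  from this[of True True] this[of True False] this[of False True] this[of False False]
  have 1: "m * ((D True True)\<^sup>2 + (D True False)\<^sup>2 + (D False True)\<^sup>2 + (D False False)\<^sup>2)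
      \<le> E True True * D True True + E True False * D True False + E False True * D False True
      + E False False * D False False" by (simp add: algebra_simps)
  \<comment> \<open>Both distributions have total mass 1, so the log-partition difference
    \<open>L\<close>, common to all four outcomes, drops out of the sum.\<close>
  have E0: "E True True + E True False + E False True + E False False = 0"
    using dyad_q_sum[of x2 y2 r2] dyad_q_sum[of x1 y1 r1] unfolding E_def by linarith
  have "E True True * D True True + E True False * D True False + E False True * D False True
      + E False False * D False False
    = (E True True + E True False) * (x2 - x1) + (E True True + E False True) * (y2 - y1)
      + E True True * (r2 - r1) - (E True True + E True False + E False True + E False False) * L"
    by (simp add: D_def ind_def algebra_simps)
  also have "\<dots> = ?lhs"
    unfolding E0 unfolding mean_out_swap[of y1] mean_out_swap[of y2] mean_out_def[of x1]
      mean_out_def[of x2] mean_rec_def E_def by (simp add: algebra_simps)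
  finally have 2: "m * ((D True True)\<^sup>2 + (D True False)\<^sup>2 + (D False True)\<^sup>2 + (D False False)\<^sup>2) \<le> ?lhs"
    using 1 by simp
  have sq: "(p - q)\<^sup>2 \<le> 2 * p\<^sup>2 + 2 * q\<^sup>2" for p q :: real
    using sum_squares_bound[of p "-q"] by (simp add: power2_diff)
  \<comment> \<open>The three parameter increments are contrasts of the log-ratios \<open>D\<close>,
    in which \<open>L\<close> cancels. The factor 8 is the total weight of
    \<open>D False False\<close>, which enters all three contrasts.\<close>
  have comb: "X + Y + R \<le> 8 * (a + b + c + d)"
    if "X \<le> 2 * b + 2 * d" "Y \<le> 2 * c + 2 * d" "R \<le> 2 * e + 2 * f"
      "e \<le> 2 * a + 2 * b" "f \<le> 2 * c + 2 * d" "0 \<le> a" "0 \<le> b" "0 \<le> c"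
    for X Y R a b c d e f :: real
    using that by argo
  have "(x2 - x1)\<^sup>2 + (y2 - y1)\<^sup>2 + (r2 - r1)\<^sup>2
      \<le> 8 * ((D True True)\<^sup>2 + (D True False)\<^sup>2 + (D False True)\<^sup>2 + (D False False)\<^sup>2)"
  proof (rule comb)
    show "(x2 - x1)\<^sup>2 \<le> 2 * (D True False)\<^sup>2 + 2 * (D False False)\<^sup>2"
      using sq[of "D True False" "D False False"] by (simp add: D_def ind_def)
    show "(y2 - y1)\<^sup>2 \<le> 2 * (D False True)\<^sup>2 + 2 * (D False False)\<^sup>2"
      using sq[of "D False True" "D False False"] by (simp add: D_def ind_def)
    show "(r2 - r1)\<^sup>2 \<le> 2 * (D True True - D True False)\<^sup>2 + 2 * (D False True - D False False)\<^sup>2"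
      using sq[of "D True True - D True False" "D False True - D False False"] by (simp add: D_def ind_def)
  qed (rule sq zero_le_power2)+
  then have "m / 8 * ((x2 - x1)\<^sup>2 + (y2 - y1)\<^sup>2 + (r2 - r1)\<^sup>2)
      \<le> m / 8 * (8 * ((D True True)\<^sup>2 + (D True False)\<^sup>2 + (D False True)\<^sup>2 + (D False False)\<^sup>2))"
    by (rule mult_left_mono) (simp add: m_def)
  also have "\<dots> = m * ((D True True)\<^sup>2 + (D True False)\<^sup>2 + (D False True)\<^sup>2 + (D False False)\<^sup>2)"
    by simp
  also note 2
  finally show ?thesis by (simp add: m_def)
qed

text \<open>The exponent in the numerator and the logarithm of the denominator each move by at most
  the sum of the increments, so the log-probability is 2-Lipschitz. Probabilities are at most 1,
  which transfers this to the probability itself, with no restriction to a box.\<close>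

lemma dyad_q_lipschitz:
  "\<bar>dyad_q a b x2 y2 r2 - dyad_q a b x1 y1 r1\<bar> \<le> 2 * (\<bar>x2 - x1\<bar> + \<bar>y2 - y1\<bar> + \<bar>r2 - r1\<bar>)"
proof -
  have *: "dyad_q a b x2 y2 r2 - dyad_q a b x1 y1 r1 \<le> 2 * (\<bar>x2 - x1\<bar> + \<bar>y2 - y1\<bar> + \<bar>r2 - r1\<bar>)"
    (is "_ \<le> 2 * ?s") for x1 y1 r1 x2 y2 r2
  proof -
    define Z where "Z x y r = 1 + exp x + exp y + exp (x + y + r)" for x y r :: real
    have "exp x1 \<le> exp (?s + x2)" "exp y1 \<le> exp (?s + y2)"
      "exp (x1 + y1 + r1) \<le> exp (?s + (x2 + y2 + r2))" "1 \<le> exp ?s"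
      by (simp_all only: exp_le_cancel_iff one_le_exp_iff)
    then have "Z x1 y1 r1 \<le> exp ?s * Z x2 y2 r2"
      unfolding exp_add[of ?s] Z_def ring_distribs by linarith
    then have "ln (Z x1 y1 r1) \<le> ln (exp ?s * Z x2 y2 r2)"
      using dyad_Z_pos[of x1 y1 r1] dyad_Z_pos[of x2 y2 r2] by (simp add: Z_def)
    then have Z: "ln (Z x1 y1 r1) - ln (Z x2 y2 r2) \<le> ?s"
      using dyad_Z_pos[of x2 y2 r2] by (simp add: Z_def ln_mult)
    have "ln (dyad_q a b x2 y2 r2) - ln (dyad_q a b x1 y1 r1) \<le> 2 * ?s"
    proof -
      have "(x2 - x1) * ind a \<le> \<bar>x2 - x1\<bar>" "(y2 - y1) * ind b \<le> \<bar>y2 - y1\<bar>"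
        "(r2 - r1) * ind a * ind b \<le> \<bar>r2 - r1\<bar>" by (simp_all add: ind_def abs_ge_self)
      then show ?thesis using Z unfolding ln_dyad_q Z_def left_diff_distrib by argo
    qed
    then have "dyad_q a b x2 y2 r2 * (ln (dyad_q a b x2 y2 r2) - ln (dyad_q a b x1 y1 r1))
        \<le> dyad_q a b x2 y2 r2 * (2 * ?s)"
      using dyad_q_pos[of a b x2 y2 r2] by (intro mult_left_mono) auto
    also have "\<dots> \<le> 1 * (2 * ?s)"
      by (intro mult_right_mono dyad_q_le_1) auto
    finally show ?thesis
      using ln_ratio_le[of "dyad_q a b x2 y2 r2" "dyad_q a b x1 y1 r1"] dyad_q_pos
      by (simp add: algebra_simps)
  qed
  show ?thesis using *[of x1 y1 r1 x2 y2 r2] *[of x2 y2 r2 x1 y1 r1]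
    by (simp add: abs_le_iff abs_minus_commute)
qed

lemma mean_lipschitz:
  "\<bar>mean_out x2 y2 r2 - mean_out x1 y1 r1\<bar> \<le> 4 * (\<bar>x2 - x1\<bar> + \<bar>y2 - y1\<bar> + \<bar>r2 - r1\<bar>)"
  "\<bar>mean_rec x2 y2 r2 - mean_rec x1 y1 r1\<bar> \<le> 4 * (\<bar>x2 - x1\<bar> + \<bar>y2 - y1\<bar> + \<bar>r2 - r1\<bar>)"
  using dyad_q_lipschitz[of True True x2 y2 r2 x1 y1 r1] dyad_q_lipschitz[of True False x2 y2 r2 x1 y1 r1]
  unfolding mean_out_def mean_rec_def by linarith+

text \<open>Here \<open>xh\<close> is the estimator, \<open>xs\<close> the truth and
  \<open>x\<close> the competitor. The tangent is taken at the competitor. Its mean is first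
  replaced by the mean at \<open>xs - dx\<close>, at Lipschitz cost, and then by the mean at the
  truth, where strong monotonicity yields the negative quadratic term.\<close>

lemma dyad_step:
  fixes xs ys rs xh yh rh x y r :: real
  defines "dx \<equiv> x - xh" and "dy \<equiv> y - yh" and "dr \<equiv> r - rh"
  assumes "\<bar>xs\<bar> \<le> K" "\<bar>ys\<bar> \<le> K" "\<bar>rs\<bar> \<le> K"
    and "\<bar>xs - dx\<bar> \<le> K" "\<bar>ys - dy\<bar> \<le> K" "\<bar>rs - dr\<bar> \<le> K"
  shows "ln (dyad_q a b xh yh rh) - ln (dyad_q a b x y r) \<le>
      - ((ind a - mean_out xs ys rs) * dx + (ind b - mean_out ys xs rs) * dy
         + (ind a * ind b - mean_rec xs ys rs) * dr)
      - exp (- (6 * K)) / 32 * (dx\<^sup>2 + dy\<^sup>2 + dr\<^sup>2)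
      + 4 * (\<bar>x - xs + dx\<bar> + \<bar>y - ys + dy\<bar> + \<bar>r - rs + dr\<bar>) * (\<bar>dx\<bar> + \<bar>dy\<bar> + \<bar>dr\<bar>)"
proof -
  let ?e = "\<bar>x - xs + dx\<bar> + \<bar>y - ys + dy\<bar> + \<bar>r - rs + dr\<bar>"
  let ?x = "xs - dx" and ?y = "ys - dy" and ?r = "rs - dr"
  have T: "ln (dyad_q a b xh yh rh) - ln (dyad_q a b x y r) \<le>
      - ((ind a - mean_out x y r) * dx + (ind b - mean_out y x r) * dy
         + (ind a * ind b - mean_rec x y r) * dr)"
    using ln_dyad_q_tangent[of a b xh yh rh x y r] by (simp add: dx_def dy_def dr_def algebra_simps)
  have M: "exp (- (6 * K)) / 32 * (dx\<^sup>2 + dy\<^sup>2 + dr\<^sup>2)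
     \<le> (mean_out ?x ?y ?r - mean_out xs ys rs) * (- dx) + (mean_out ?y ?x ?r - mean_out ys xs rs) * (- dy)
     + (mean_rec ?x ?y ?r - mean_rec xs ys rs) * (- dr)"
  proof -
    have "?x - xs = - dx" "?y - ys = - dy" "?r - rs = - dr" by simp_all
    then show ?thesis
      using mean_strongly_monotone[OF assms(4-9)] by (simp only: power2_minus)
  qed
  have L: "\<bar>mean_out x y r - mean_out ?x ?y ?r\<bar> \<le> 4 * ?e" "\<bar>mean_out y x r - mean_out ?y ?x ?r\<bar> \<le> 4 * ?e"
      "\<bar>mean_rec x y r - mean_rec ?x ?y ?r\<bar> \<le> 4 * ?e"
    using mean_lipschitz[of x y r ?x ?y ?r] mean_lipschitz(1)[of y x r ?y ?x ?r]
    by (simp_all add: algebra_simps)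
  have P: "p * d \<le> 4 * ?e * \<bar>d\<bar>" if "\<bar>p\<bar> \<le> 4 * ?e" for p d :: real
    using mult_right_mono[OF that abs_ge_zero[of d]] abs_ge_self[of "p * d"] by (simp add: abs_mult)
  have "(mean_out x y r - mean_out ?x ?y ?r) * dx + (mean_out y x r - mean_out ?y ?x ?r) * dy
     + (mean_rec x y r - mean_rec ?x ?y ?r) * dr \<le> 4 * ?e * (\<bar>dx\<bar> + \<bar>dy\<bar> + \<bar>dr\<bar>)"
    using P[OF L(1), of dx] P[OF L(2), of dy] P[OF L(3), of dr] unfolding ring_distribs by linarith
  with T M show ?thesis by (simp add: algebra_simps)
qed

section \<open>Competitors of the maximum likelihood estimator\<close>

definition noise_out :: "(nat \<Rightarrow> real) \<Rightarrow> (nat \<Rightarrow> real) \<Rightarrow> real \<Rightarrow> (nat \<Rightarrow> nat \<Rightarrow> bool) \<Rightarrow> nat \<Rightarrow> nat \<Rightarrow> real" where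
  "noise_out \<alpha> \<beta> \<rho> a i j = ind (a i j) - mean_out (\<alpha> i + \<beta> j) (\<beta> i + \<alpha> j) \<rho>"

definition noise_rec :: "(nat \<Rightarrow> real) \<Rightarrow> (nat \<Rightarrow> real) \<Rightarrow> real \<Rightarrow> (nat \<Rightarrow> nat \<Rightarrow> bool) \<Rightarrow> nat \<Rightarrow> nat \<Rightarrow> real" where
  "noise_rec \<alpha> \<beta> \<rho> a i j = ind (a i j) * ind (a j i) - mean_rec (\<alpha> i + \<beta> j) (\<beta> i + \<alpha> j) \<rho>"

section \<open>Sums over dyads and over ordered pairs of nodes\<close>

lemma finite_pairs [simp]: "finite (pairs n)"
  by (rule finite_subset[of _ "{1..n} \<times> {1..n}"]) (auto simp: pairs_def)

text \<open>Exchanging the coordinates maps the pairs above the diagonal onto those below it.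
  Likelihood terms, indexed by dyads, can thus be regrouped by node.\<close>

lemma sum_pairs_symmetrize:
  fixes F :: "nat \<Rightarrow> nat \<Rightarrow> real"
  shows "(\<Sum>(i, j)\<in>pairs n. F i j + F j i) = (\<Sum>i\<in>{1..n}. \<Sum>j\<in>{1..n} - {i}. F i j)"
proof -
  have inj: "inj_on prod.swap (pairs n)" by (auto simp: inj_on_def)
  have "(\<Sum>i\<in>{1..n}. \<Sum>j\<in>{1..n} - {i}. F i j) = (\<Sum>(i, j)\<in>(SIGMA i:{1..n}. {1..n} - {i}). F i j)"
    by (subst sum.Sigma) auto
  also have "(SIGMA i:{1..n}. {1..n} - {i}) = pairs n \<union> prod.swap ` pairs n"
    by (auto simp: pairs_def image_iff)
  also have "(\<Sum>(i, j)\<in>\<dots>. F i j) = (\<Sum>(i, j)\<in>pairs n. F i j) + (\<Sum>(i, j)\<in>prod.swap ` pairs n. F i j)"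
    by (intro sum.union_disjoint finite_imageI finite_pairs) (auto simp: pairs_def)
  also have "(\<Sum>(i, j)\<in>prod.swap ` pairs n. F i j) = (\<Sum>(i, j)\<in>pairs n. F j i)"
    by (subst sum.reindex[OF inj]) (simp add: case_prod_unfold)
  finally show ?thesis by (simp add: sum.distrib case_prod_unfold)
qed

lemma sum_offdiag_swap:
  fixes F :: "nat \<Rightarrow> nat \<Rightarrow> real"
  shows "(\<Sum>i\<in>{1..n}. \<Sum>j\<in>{1..n} - {i}. F i j) = (\<Sum>j\<in>{1..n}. \<Sum>i\<in>{1..n} - {j}. F i j)"
  unfolding sum_pairs_symmetrize[symmetric] by (simp add: add.commute)

lemma sum_offdiag_split:
  fixes F :: "nat \<Rightarrow> nat \<Rightarrow> real"
  shows "(\<Sum>i\<in>{1..n}. \<Sum>j\<in>{1..n}. F i j) = (\<Sum>i\<in>{1..n}. \<Sum>j\<in>{1..n} - {i}. F i j) + (\<Sum>i\<in>{1..n}. F i i)"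
  by (simp add: sum.distrib[symmetric] sum_diff1)

lemma param_space_bounds:
  assumes "(\<alpha>, \<beta>, \<rho>) \<in> param_space n B" "i \<in> {1..n}"
  shows "\<bar>\<alpha> i\<bar> \<le> B" "\<bar>\<beta> i\<bar> \<le> B" "\<bar>\<rho>\<bar> \<le> B"
  using assms by (auto simp: param_space_def)

text \<open>The constant of \<open>mean_strongly_monotone\<close> for \<open>K = 6 * B\<close>, which bounds the truth displaced by
  the difference of two feasible parameters.\<close>

definition curv :: "real \<Rightarrow> real" where
  "curv B = exp (- (36 * B)) / 32"

lemma curv_pos: "0 < curv B"
  by (simp add: curv_def)

lemma curv_le_1: "0 < B \<Longrightarrow> curv B \<le> 1"
  by (simp add: curv_def) (smt (verit) exp_le_one_iff)

section \<open>Likelihood comparisons for one fixed graph\<close>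

locale mle =
  fixes n :: nat and B :: real and a :: "nat \<Rightarrow> nat \<Rightarrow> bool"
    and \<alpha>s \<beta>s :: "nat \<Rightarrow> real" and \<rho>s :: real
    and \<alpha>h \<beta>h :: "nat \<Rightarrow> real" and \<rho>h :: real
  assumes n_ge_2: "2 \<le> n" and B_pos: "0 < B"
    and true_in: "(\<alpha>s, \<beta>s, \<rho>s) \<in> param_space n B"
    and est_in: "(\<alpha>h, \<beta>h, \<rho>h) \<in> param_space n B"
    and maximal: "\<And>\<alpha> \<beta> \<rho>. (\<alpha>, \<beta>, \<rho>) \<in> param_space n B \<Longrightarrow> loglik n a \<alpha> \<beta> \<rho> \<le> loglik n a \<alpha>h \<beta>h \<rho>h"
begin

abbreviation "Nz \<equiv> noise_out \<alpha>s \<beta>s \<rho>s a"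
abbreviation "Mz \<equiv> noise_rec \<alpha>s \<beta>s \<rho>s a"

text \<open>Writing the deviation of the competitor from the truth as \<open>- d + e\<close> isolates the part \<open>- d\<close>
  on which strong monotonicity of the mean map is used; \<open>e\<close> is only estimated by the Lipschitz bound.\<close>

lemma basic_inequality:
  assumes "(\<alpha>, \<beta>, \<rho>) \<in> param_space n B"
  defines "da \<equiv> \<lambda>i. \<alpha> i - \<alpha>h i" and "db \<equiv> \<lambda>i. \<beta> i - \<beta>h i" and "dr \<equiv> \<rho> - \<rho>h"
    and "ea \<equiv> \<lambda>i. 2 * \<alpha> i - \<alpha>h i - \<alpha>s i" and "eb \<equiv> \<lambda>i. 2 * \<beta> i - \<beta>h i - \<beta>s i"
    and "er \<equiv> 2 * \<rho> - \<rho>h - \<rho>s"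
  shows "0 \<le> (\<Sum>i\<in>{1..n}. \<Sum>j\<in>{1..n} - {i}.
      - (Nz i j * (da i + db j) + Mz i j * dr / 2) - curv B * ((da i + db j)\<^sup>2 + dr\<^sup>2 / 2)
      + 2 * (\<bar>ea i + eb j\<bar> + \<bar>eb i + ea j\<bar> + \<bar>er\<bar>) * (\<bar>da i + db j\<bar> + \<bar>db i + da j\<bar> + \<bar>dr\<bar>))"
    (is "0 \<le> (\<Sum>i\<in>_. \<Sum>j\<in>_. ?G i j)")
proof -
  have pair: "ln (dyad_g (a i j) (a j i) (\<alpha>h i) (\<beta>h i) (\<alpha>h j) (\<beta>h j) \<rho>h)
      - ln (dyad_g (a i j) (a j i) (\<alpha> i) (\<beta> i) (\<alpha> j) (\<beta> j) \<rho>) \<le> ?G i j + ?G j i"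
    if ij: "(i, j) \<in> pairs n" for i j
  proof -
    have I: "i \<in> {1..n}" "j \<in> {1..n}" using ij by (auto simp: pairs_def)
    note bds = param_space_bounds[OF true_in I(1)] param_space_bounds[OF true_in I(2)]
      param_space_bounds[OF est_in I(1)] param_space_bounds[OF est_in I(2)]
      param_space_bounds[OF assms(1) I(1)] param_space_bounds[OF assms(1) I(2)]
    note bd = bds[unfolded abs_le_iff]
    \<comment> \<open>The displaced truth is a signed sum of six parameters, each bounded by
      \<open>B\<close>.\<close>
    have K: "\<bar>\<alpha>s i + \<beta>s j\<bar> \<le> 6 * B" "\<bar>\<beta>s i + \<alpha>s j\<bar> \<le> 6 * B" "\<bar>\<rho>s\<bar> \<le> 6 * B"
      "\<bar>\<alpha>s i + \<beta>s j - (\<alpha> i + \<beta> j - (\<alpha>h i + \<beta>h j))\<bar> \<le> 6 * B"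
      "\<bar>\<beta>s i + \<alpha>s j - (\<beta> i + \<alpha> j - (\<beta>h i + \<alpha>h j))\<bar> \<le> 6 * B"
      "\<bar>\<rho>s - (\<rho> - \<rho>h)\<bar> \<le> 6 * B"
      unfolding abs_le_iff using bd B_pos by linarith+
    \<comment> \<open>The reciprocity noise is symmetric, so each of the two orientations of a dyad
      can carry half of the terms in \<open>dr\<close>.\<close>
    have "Mz j i = Mz i j"
      by (simp add: noise_rec_def add.commute mult.commute) (rule mean_rec_swap)
    moreover have "\<beta> i + \<alpha> j - (\<beta>h i + \<alpha>h j) = da j + db i" "\<alpha> i + \<beta> j - (\<alpha>h i + \<beta>h j) = da i + db j"
      "\<alpha> i + \<beta> j - (\<alpha>s i + \<beta>s j) + (da i + db j) = ea i + eb j"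
      "\<beta> i + \<alpha> j - (\<beta>s i + \<alpha>s j) + (da j + db i) = eb i + ea j" 
      "\<rho> - \<rho>h = dr" "\<rho> - \<rho>s + dr = er"
      by (simp_all add: da_def db_def ea_def eb_def dr_def er_def)
    moreover have "exp (- (6 * (6 * B))) / 32 = curv B" by (simp add: curv_def)
    ultimately have "ln (dyad_g (a i j) (a j i) (\<alpha>h i) (\<beta>h i) (\<alpha>h j) (\<beta>h j) \<rho>h)
      - ln (dyad_g (a i j) (a j i) (\<alpha> i) (\<beta> i) (\<alpha> j) (\<beta> j) \<rho>) \<le>
      - (Nz i j * (da i + db j) + Nz j i * (da j + db i) + Mz i j * dr)
      - curv B * ((da i + db j)\<^sup>2 + (da j + db i)\<^sup>2 + dr\<^sup>2)
      + 4 * (\<bar>ea i + eb j\<bar> + \<bar>eb i + ea j\<bar> + \<bar>er\<bar>) * (\<bar>da i + db j\<bar> + \<bar>da j + db i\<bar> + \<bar>dr\<bar>)"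
      using dyad_step[OF K, of "a i j" "a j i"] unfolding dyad_g_eq noise_out_def noise_rec_def
      by (simp add: add.commute)
    also have "\<dots> = ?G i j + ?G j i"
      using \<open>Mz j i = Mz i j\<close> by (simp add: algebra_simps)
    finally show ?thesis .
  qed
  have "0 \<le> (\<Sum>(i, j)\<in>pairs n. ln (dyad_g (a i j) (a j i) (\<alpha>h i) (\<beta>h i) (\<alpha>h j) (\<beta>h j) \<rho>h)
      - ln (dyad_g (a i j) (a j i) (\<alpha> i) (\<beta> i) (\<alpha> j) (\<beta> j) \<rho>))"
    using maximal[OF assms(1)] unfolding loglik_def by (simp add: sum_subtractf case_prod_unfold)
  also have "\<dots> \<le> (\<Sum>(i, j)\<in>pairs n. ?G i j + ?G j i)"
    using pair by (intro sum_mono) auto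
  finally show ?thesis unfolding sum_pairs_symmetrize .
qed

end

text \<open>The event that will have high probability; on it the remaining error analysis is
  deterministic.\<close>

locale mle_concentrated = mle +
  fixes t :: real
  assumes row: "\<And>i. i \<in> {1..n} \<Longrightarrow> \<bar>\<Sum>j\<in>{1..n} - {i}. Nz i j\<bar> \<le> t"
    and col: "\<And>i. i \<in> {1..n} \<Longrightarrow> \<bar>\<Sum>j\<in>{1..n} - {i}. Nz j i\<bar> \<le> t"
    and rec: "\<And>i. i \<in> {1..n} \<Longrightarrow> \<bar>\<Sum>j\<in>{1..n} - {i}. Mz i j\<bar> \<le> t"
begin

abbreviation "\<delta>a i \<equiv> \<alpha>h i - \<alpha>s i"
abbreviation "\<delta>b i \<equiv> \<beta>h i - \<beta>s i"
abbreviation "\<delta>r \<equiv> \<rho>h - \<rho>s"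

lemma t_nonneg: "0 \<le> t"
  using row[of 1] n_ge_2 by force

lemma weighted_sum_le:
  fixes w S :: "nat \<Rightarrow> real"
  assumes "\<And>i. i \<in> {1..n} \<Longrightarrow> \<bar>S i\<bar> \<le> t"
  shows "(\<Sum>i\<in>{1..n}. w i * S i) \<le> t * (\<Sum>i\<in>{1..n}. \<bar>w i\<bar>)"
proof -
  have "w i * S i \<le> t * \<bar>w i\<bar>" if "i \<in> {1..n}" for i
    using mult_left_mono[OF assms[OF that] abs_ge_zero[of "w i"]] abs_ge_self[of "w i * S i"]
    by (simp add: abs_mult mult.commute)
  then show ?thesis unfolding sum_distrib_left by (intro sum_mono)
qed

text \<open>Exchanging the order of summation in the \<open>q\<close> part pairs \<open>p\<close>
  with row sums and \<open>q\<close> with column sums, each of size at most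
  \<open>t\<close>.\<close>

lemma noise_le:
  "(\<Sum>i\<in>{1..n}. \<Sum>j\<in>{1..n} - {i}. Nz i j * (p i + q j))
     \<le> t * (\<Sum>i\<in>{1..n}. \<bar>p i\<bar> + \<bar>q i\<bar>)"
proof -
  have "(\<Sum>i\<in>{1..n}. \<Sum>j\<in>{1..n} - {i}. Nz i j * (p i + q j))
    = (\<Sum>i\<in>{1..n}. \<Sum>j\<in>{1..n} - {i}. p i * Nz i j) + (\<Sum>i\<in>{1..n}. \<Sum>j\<in>{1..n} - {i}. q j * Nz i j)"
    by (simp add: sum.distrib algebra_simps)
  also have "(\<Sum>i\<in>{1..n}. \<Sum>j\<in>{1..n} - {i}. q j * Nz i j) = (\<Sum>j\<in>{1..n}. \<Sum>i\<in>{1..n} - {j}. q j * Nz i j)"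
    by (rule sum_offdiag_swap)
  finally have "(\<Sum>i\<in>{1..n}. \<Sum>j\<in>{1..n} - {i}. Nz i j * (p i + q j))
    = (\<Sum>i\<in>{1..n}. p i * (\<Sum>j\<in>{1..n} - {i}. Nz i j)) + (\<Sum>j\<in>{1..n}. q j * (\<Sum>i\<in>{1..n} - {j}. Nz i j))"
    by (simp add: sum_distrib_left)
  also have "\<dots> \<le> t * (\<Sum>i\<in>{1..n}. \<bar>p i\<bar>) + t * (\<Sum>i\<in>{1..n}. \<bar>q i\<bar>)"
    by (intro add_mono weighted_sum_le row col)
  finally show ?thesis by (simp add: sum.distrib distrib_left)
qed

text \<open>The competitor is the midpoint of estimator and truth: it is feasible because the box is
  convex, and for it \<open>e\<close> vanishes, so no Lipschitz term remains. The noise is bounded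
  crudely by errors of size \<open>2 * B\<close> per parameter.\<close>

lemma energy_bound:
  "curv B * (\<Sum>i\<in>{1..n}. \<Sum>j\<in>{1..n} - {i}. (\<delta>a i + \<delta>b j)\<^sup>2 + \<delta>r\<^sup>2 / 2) \<le> 10 * B * n * t"
proof -
  let ?I = "{1..n}"
  define \<alpha> where "\<alpha> i = (\<alpha>h i + \<alpha>s i) / 2" for i
  define \<beta> where "\<beta> i = (\<beta>h i + \<beta>s i) / 2" for i
  define \<rho> where "\<rho> = (\<rho>h + \<rho>s) / 2"
  have mem: "(\<alpha>, \<beta>, \<rho>) \<in> param_space n B"
  proof -
    have "\<bar>\<alpha> i\<bar> \<le> B \<and> \<bar>\<beta> i\<bar> \<le> B" if i: "i \<in> ?I" for i
      using param_space_bounds[OF true_in i] param_space_bounds[OF est_in i]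
      by (auto simp: \<alpha>_def \<beta>_def)
    then show ?thesis
      using true_in est_in unfolding param_space_def by (auto simp: \<alpha>_def \<beta>_def \<rho>_def)
  qed
  have eqs: "\<alpha> i - \<alpha>h i = - \<delta>a i / 2" "\<beta> i - \<beta>h i = - \<delta>b i / 2" "2 * \<alpha> i - \<alpha>h i - \<alpha>s i = 0"
    "2 * \<beta> i - \<beta>h i - \<beta>s i = 0" "\<rho> - \<rho>h = - \<delta>r / 2" "2 * \<rho> - \<rho>h - \<rho>s = 0" for i
    by (simp_all add: \<alpha>_def \<beta>_def \<rho>_def field_simps)
  have "0 \<le> (\<Sum>i\<in>?I. \<Sum>j\<in>?I - {i}.
      - (Nz i j * (- \<delta>a i / 2 + - \<delta>b j / 2) + Mz i j * (- \<delta>r / 2) / 2)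
      - curv B * ((- \<delta>a i / 2 + - \<delta>b j / 2)\<^sup>2 + (- \<delta>r / 2)\<^sup>2 / 2))"
    using basic_inequality[OF mem] unfolding eqs by simp
  also have "\<dots> = (\<Sum>i\<in>?I. \<Sum>j\<in>?I - {i}. Nz i j * (\<delta>a i + \<delta>b j) / 2 + Mz i j * \<delta>r / 4
      - curv B / 4 * ((\<delta>a i + \<delta>b j)\<^sup>2 + \<delta>r\<^sup>2 / 2))"
    by (intro sum.cong refl) (simp add: power2_eq_square field_simps)
  also have "\<dots> = (\<Sum>i\<in>?I. \<Sum>j\<in>?I - {i}. Nz i j * (\<delta>a i + \<delta>b j)) / 2
      + (\<Sum>i\<in>?I. \<delta>r / 4 * (\<Sum>j\<in>?I - {i}. Mz i j))
      - curv B / 4 * (\<Sum>i\<in>?I. \<Sum>j\<in>?I - {i}. (\<delta>a i + \<delta>b j)\<^sup>2 + \<delta>r\<^sup>2 / 2)"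
    unfolding sum_subtractf sum.distrib[where g = "\<lambda>i. Mz _ i * _ / 4"] sum_distrib_left sum_divide_distrib
    by (simp add: sum_subtractf sum.distrib mult.commute)
  finally have "curv B / 4 * (\<Sum>i\<in>?I. \<Sum>j\<in>?I - {i}. (\<delta>a i + \<delta>b j)\<^sup>2 + \<delta>r\<^sup>2 / 2)
      \<le> (\<Sum>i\<in>?I. \<Sum>j\<in>?I - {i}. Nz i j * (\<delta>a i + \<delta>b j)) / 2
      + (\<Sum>i\<in>?I. \<delta>r / 4 * (\<Sum>j\<in>?I - {i}. Mz i j))" by linarith
  also have "\<dots> \<le> t * (\<Sum>i\<in>?I. \<bar>\<delta>a i\<bar> + \<bar>\<delta>b i\<bar>) / 2 + t * (\<Sum>i\<in>?I. \<bar>\<delta>r / 4\<bar>)"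
    by (intro add_mono divide_right_mono noise_le weighted_sum_le rec) auto
  also have "\<dots> \<le> t * (\<Sum>i\<in>?I. 4 * B) / 2 + t * (\<Sum>i\<in>?I. B / 2)"
  proof -
    have "\<bar>\<delta>a i\<bar> + \<bar>\<delta>b i\<bar> \<le> 4 * B" if "i \<in> ?I" for i
      using param_space_bounds[OF true_in that] param_space_bounds[OF est_in that] by linarith
    moreover have "\<bar>\<delta>r / 4\<bar> \<le> B / 2"
    proof -
      have "\<bar>\<delta>r\<bar> \<le> 2 * B"
        using true_in est_in unfolding param_space_def by auto
      then show ?thesis by simp
    qed
    ultimately show ?thesis
      using t_nonneg by (intro add_mono divide_right_mono mult_left_mono sum_mono) auto
  qed
  finally show ?thesis by (simp add: algebra_simps)
qed

text \<open>The competitor parameter moves the nodes of \<open>A\<close> half-way to the truth and shifts all other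
  nodes along the direction \<open>(\<kappa>/2, - \<kappa>/2)\<close>, which changes no dyad outside \<open>A\<close>. Only the noise in
  the rows and columns of \<open>A\<close> enters.\<close>

lemma displacement_bound:
  fixes \<kappa> s :: real
  defines "u \<equiv> \<lambda>i. \<delta>a i + \<kappa>" and "v \<equiv> \<lambda>i. \<delta>b i - \<kappa>"
  assumes A: "A \<subseteq> {1..n}" "A \<noteq> {}" "2 * card A \<le> n"
    and gauge: "1 \<in> A \<or> \<kappa> = 0"
    and feasible: "\<And>i. i \<in> {1..n} - A \<Longrightarrow> \<bar>\<alpha>h i + \<kappa> / 2\<bar> \<le> B \<and> \<bar>\<beta>h i - \<kappa> / 2\<bar> \<le> B"
    and s: "0 < s" "\<And>i. i \<in> A \<Longrightarrow> s \<le> \<bar>u i\<bar> + \<bar>v i\<bar>"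
  shows "curv B * n * s \<le> 8 * (t + 4 * (\<Sum>i\<in>{1..n}. \<bar>u i\<bar> + \<bar>v i\<bar>) + 4 * n * \<bar>\<delta>r\<bar>)"
proof -
  let ?I = "{1..n}"
  define \<alpha> where "\<alpha> i = (if i \<in> A then (\<alpha>h i + \<alpha>s i) / 2 else if i \<in> ?I then \<alpha>h i + \<kappa> / 2 else 0)" for i
  define \<beta> where "\<beta> i = (if i \<in> A then (\<beta>h i + \<beta>s i) / 2 else if i \<in> ?I then \<beta>h i - \<kappa> / 2 else 0)" for i
  \<comment> \<open>\<open>p\<close> and \<open>q\<close> are the displacements from the estimator
    with the common shift removed. The shift cancels in \<open>p i + q j\<close>. By contrast
    \<open>w\<close>, the size of \<open>e\<close>, vanishes on \<open>A\<close>, where the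
    competitor is the midpoint.\<close>
  define p where "p i = (if i \<in> A then - u i / 2 else 0)" for i
  define q where "q i = (if i \<in> A then - v i / 2 else 0)" for i
  define \<chi> where "\<chi> i = (if i \<in> A then 1 else 0 :: real)" for i
  define w where "w i = (if i \<in> A then 0 else \<bar>u i\<bar> + \<bar>v i\<bar>)" for i
  define g where "g i = \<bar>p i\<bar> + \<bar>q i\<bar>" for i
  define G where "G = (\<Sum>i\<in>?I. g i)"
  define W where "W = (\<Sum>i\<in>?I. \<bar>u i\<bar> + \<bar>v i\<bar>)"
  have mem: "(\<alpha>, \<beta>, \<rho>h) \<in> param_space n B"
  proof -
    have 1: "\<bar>\<alpha> i\<bar> \<le> B \<and> \<bar>\<beta> i\<bar> \<le> B" if i: "i \<in> ?I" for i
      using param_space_bounds[OF true_in i] param_space_bounds[OF est_in i] feasible[of i] i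
      by (auto simp: \<alpha>_def \<beta>_def)
    \<comment> \<open>Either node 1 moves to the midpoint of two zeros, or there is no shift; the
      normalization survives in both cases.\<close>
    have "\<alpha> 1 = 0"
      using gauge true_in est_in by (auto simp: \<alpha>_def param_space_def)
    moreover have "\<alpha> i = 0 \<and> \<beta> i = 0" if "i \<notin> ?I" for i
      using that A(1) by (auto simp: \<alpha>_def \<beta>_def)
    moreover have "\<bar>\<rho>h\<bar> \<le> B" using est_in by (simp add: param_space_def)
    ultimately show ?thesis using 1 unfolding param_space_def by blast
  qed
  have term_le: "- (Nz i j * ((\<alpha> i - \<alpha>h i) + (\<beta> j - \<beta>h j)) + Mz i j * (\<rho>h - \<rho>h) / 2)
      - curv B * (((\<alpha> i - \<alpha>h i) + (\<beta> j - \<beta>h j))\<^sup>2 + (\<rho>h - \<rho>h)\<^sup>2 / 2)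
      + 2 * (\<bar>(2 * \<alpha> i - \<alpha>h i - \<alpha>s i) + (2 * \<beta> j - \<beta>h j - \<beta>s j)\<bar>
           + \<bar>(2 * \<beta> i - \<beta>h i - \<beta>s i) + (2 * \<alpha> j - \<alpha>h j - \<alpha>s j)\<bar> + \<bar>2 * \<rho>h - \<rho>h - \<rho>s\<bar>)
        * (\<bar>(\<alpha> i - \<alpha>h i) + (\<beta> j - \<beta>h j)\<bar> + \<bar>(\<beta> i - \<beta>h i) + (\<alpha> j - \<alpha>h j)\<bar> + \<bar>\<rho>h - \<rho>h\<bar>)
     \<le> Nz i j * (- p i + - q j) - curv B * ((p i)\<^sup>2 * (1 - \<chi> j) + (q j)\<^sup>2 * (1 - \<chi> i))
      + 2 * ((w i + w j + \<bar>\<delta>r\<bar>) * (g i + g j))"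
    if i: "i \<in> ?I" and j: "j \<in> ?I - {i}" for i j
  proof -
    have d: "\<alpha> k - \<alpha>h k = p k + \<kappa> / 2" "\<beta> k - \<beta>h k = q k - \<kappa> / 2" if "k \<in> ?I" for k
      using that by (simp_all add: \<alpha>_def \<beta>_def p_def q_def u_def v_def field_simps)
    have e: "2 * \<alpha> k - \<alpha>h k - \<alpha>s k = (if k \<in> A then 0 else u k)"
      "2 * \<beta> k - \<beta>h k - \<beta>s k = (if k \<in> A then 0 else v k)" if "k \<in> ?I" for k
      using that by (simp_all add: \<alpha>_def \<beta>_def u_def v_def field_simps)
    have jI: "j \<in> ?I" using j by simp
    have dij: "(\<alpha> i - \<alpha>h i) + (\<beta> j - \<beta>h j) = p i + q j" "(\<beta> i - \<beta>h i) + (\<alpha> j - \<alpha>h j) = q i + p j"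
      using d[OF i] d[OF jI] by simp_all
    \<comment> \<open>Pairs inside \<open>A\<close> are given up, since \<open>p i\<close> and
      \<open>q j\<close> may cancel there. When an end lies outside \<open>A\<close>, only one of
      the two terms can be nonzero and nothing is lost.\<close>
    have sq: "(p i)\<^sup>2 * (1 - \<chi> j) + (q j)\<^sup>2 * (1 - \<chi> i) \<le> (p i + q j)\<^sup>2"
      by (simp add: \<chi>_def p_def q_def)
    have "\<bar>(2 * \<alpha> i - \<alpha>h i - \<alpha>s i) + (2 * \<beta> j - \<beta>h j - \<beta>s j)\<bar>
           + \<bar>(2 * \<beta> i - \<beta>h i - \<beta>s i) + (2 * \<alpha> j - \<alpha>h j - \<alpha>s j)\<bar> + \<bar>2 * \<rho>h - \<rho>h - \<rho>s\<bar>
        \<le> w i + w j + \<bar>\<delta>r\<bar>"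
      unfolding e[OF i] e[OF jI] w_def by auto
    moreover have "\<bar>p i + q j\<bar> + \<bar>q i + p j\<bar> + \<bar>\<rho>h - \<rho>h\<bar> \<le> g i + g j"
      unfolding g_def by auto
    ultimately have "(\<bar>(2 * \<alpha> i - \<alpha>h i - \<alpha>s i) + (2 * \<beta> j - \<beta>h j - \<beta>s j)\<bar>
           + \<bar>(2 * \<beta> i - \<beta>h i - \<beta>s i) + (2 * \<alpha> j - \<alpha>h j - \<alpha>s j)\<bar> + \<bar>2 * \<rho>h - \<rho>h - \<rho>s\<bar>)
        * (\<bar>p i + q j\<bar> + \<bar>q i + p j\<bar> + \<bar>\<rho>h - \<rho>h\<bar>) \<le> (w i + w j + \<bar>\<delta>r\<bar>) * (g i + g j)"
      by (intro mult_mono) (auto simp: w_def)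
    with mult_left_mono[OF sq less_imp_le[OF curv_pos[of B]]] show ?thesis
      unfolding dij by (simp add: algebra_simps)
  qed
  have "0 \<le> (\<Sum>i\<in>?I. \<Sum>j\<in>?I - {i}.
      Nz i j * (- p i + - q j) - curv B * ((p i)\<^sup>2 * (1 - \<chi> j) + (q j)\<^sup>2 * (1 - \<chi> i))
      + 2 * ((w i + w j + \<bar>\<delta>r\<bar>) * (g i + g j)))"
    by (rule order_trans[OF basic_inequality[OF mem]]) (intro sum_mono term_le)
  also have "\<dots> = (\<Sum>i\<in>?I. \<Sum>j\<in>?I - {i}. Nz i j * (- p i + - q j))
      - curv B * (\<Sum>i\<in>?I. \<Sum>j\<in>?I - {i}. (p i)\<^sup>2 * (1 - \<chi> j) + (q j)\<^sup>2 * (1 - \<chi> i))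
      + 2 * (\<Sum>i\<in>?I. \<Sum>j\<in>?I - {i}. (w i + w j + \<bar>\<delta>r\<bar>) * (g i + g j))"
    by (simp only: sum.distrib[of "\<lambda>j. _ j - _ j"] sum_subtractf sum_distrib_left)
  finally have total: "0 \<le> \<dots>" .
  have noise: "(\<Sum>i\<in>?I. \<Sum>j\<in>?I - {i}. Nz i j * (- p i + - q j)) \<le> t * G"
    using noise_le[of "\<lambda>i. - p i" "\<lambda>i. - q i"] by (simp add: G_def g_def)
  have cross: "(\<Sum>i\<in>?I. \<Sum>j\<in>?I - {i}. (w i + w j + \<bar>\<delta>r\<bar>) * (g i + g j)) \<le> 2 * (W * G) + 2 * (n * \<bar>\<delta>r\<bar> * G)"
  proof -
    \<comment> \<open>The supports of \<open>w\<close> and \<open>g\<close> are disjoint, so the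
      products \<open>w i * g i\<close> vanish and the remaining sums factor.\<close>
    have g0: "0 \<le> g i" and w0: "0 \<le> w i" and wg: "w i * g i = 0" for i
      by (simp_all add: g_def w_def p_def q_def)
    have "(\<Sum>i\<in>?I. \<Sum>j\<in>?I - {i}. (w i + w j + \<bar>\<delta>r\<bar>) * (g i + g j))
        \<le> (\<Sum>i\<in>?I. \<Sum>j\<in>?I. (w i + w j + \<bar>\<delta>r\<bar>) * (g i + g j))"
      by (intro sum_mono sum_mono2) (auto simp: g0 w0)
    also have "\<dots> = (\<Sum>i\<in>?I. \<Sum>j\<in>?I. w i * g j + g i * w j + \<bar>\<delta>r\<bar> * g i + \<bar>\<delta>r\<bar> * g j)"
      proof (intro sum.cong refl)
      fix i j
      show "(w i + w j + \<bar>\<delta>r\<bar>) * (g i + g j) = w i * g j + g i * w j + \<bar>\<delta>r\<bar> * g i + \<bar>\<delta>r\<bar> * g j"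
        using wg[of i] wg[of j] by (simp only: distrib_left distrib_right) (simp add: mult.commute)
    qed
    also have "\<dots> = 2 * ((\<Sum>i\<in>?I. w i) * G) + 2 * (n * \<bar>\<delta>r\<bar> * G)"
      by (simp add: sum.distrib G_def sum_distrib_left[symmetric] sum_distrib_right[symmetric] algebra_simps)
    also have "\<dots> \<le> 2 * (W * G) + 2 * (n * \<bar>\<delta>r\<bar> * G)"
      unfolding W_def G_def
      by (intro add_mono mult_left_mono mult_right_mono sum_mono sum_nonneg) (auto simp: w_def g0)
    finally show ?thesis .
  qed
  \<comment> \<open>At least half of the nodes lie outside \<open>A\<close>, so each displaced node
    meets at least \<open>n / 2\<close> undisplaced ones. On \<open>A\<close> the bound
    \<open>s / 2 \<le> g i\<close> turns squares into multiples of \<open>g i\<close>.\<close>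
  have coercive: "(\<Sum>i\<in>?I. \<Sum>j\<in>?I - {i}. (p i)\<^sup>2 * (1 - \<chi> j) + (q j)\<^sup>2 * (1 - \<chi> i)) \<ge> n * (G * s) / 8"
  proof -
    have chi: "(\<Sum>i\<in>?I. 1 - \<chi> i) \<ge> n / 2"
    proof -
      have "(\<Sum>i\<in>?I. \<chi> i) = card A"
        using A(1) by (simp add: \<chi>_def sum.If_cases Int_absorb1)
      then show ?thesis using A(3) by (simp add: sum_subtractf)
    qed
    have pq: "g i * s / 4 \<le> (p i)\<^sup>2 + (q i)\<^sup>2" for i
    proof (cases "i \<in> A")
      case True
      have "s / 2 \<le> g i" using s(2)[OF True] True by (simp add: g_def p_def q_def)
      then have "g i * (s / 2) \<le> g i * g i"
        by (intro mult_left_mono) (auto simp: g_def)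
      moreover have "g i * g i \<le> 2 * ((p i)\<^sup>2 + (q i)\<^sup>2)"
        using sum_squares_bound[of "\<bar>p i\<bar>" "\<bar>q i\<bar>"]
        by (simp add: g_def power2_eq_square algebra_simps)
      ultimately have "g i * (s / 2) \<le> 2 * ((p i)\<^sup>2 + (q i)\<^sup>2)" by (rule order_trans)
      then show ?thesis by simp
    qed (simp add: g_def p_def q_def)
    have "n * (G * s) / 8 = n / 2 * (\<Sum>i\<in>?I. g i * s / 4)"
      by (simp add: G_def sum_distrib_right sum_divide_distrib[symmetric])
    also have "\<dots> \<le> (\<Sum>j\<in>?I. 1 - \<chi> j) * (\<Sum>i\<in>?I. (p i)\<^sup>2 + (q i)\<^sup>2)"
      using chi s(1) by (intro mult_mono sum_mono pq sum_nonneg) (auto simp: \<chi>_def g_def)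
    also have "\<dots> = (\<Sum>i\<in>?I. \<Sum>j\<in>?I. (p i)\<^sup>2 * (1 - \<chi> j)) + (\<Sum>i\<in>?I. \<Sum>j\<in>?I. (1 - \<chi> i) * (q j)\<^sup>2)"
      unfolding sum.distrib distrib_left sum_product by (subst (1) sum.swap) (simp add: mult.commute)
    also have "\<dots> = (\<Sum>i\<in>?I. \<Sum>j\<in>?I. (p i)\<^sup>2 * (1 - \<chi> j) + (q j)\<^sup>2 * (1 - \<chi> i))"
      by (simp add: sum.distrib mult.commute)
    also have "\<dots> = (\<Sum>i\<in>?I. \<Sum>j\<in>?I - {i}. (p i)\<^sup>2 * (1 - \<chi> j) + (q j)\<^sup>2 * (1 - \<chi> i))"
      unfolding sum_offdiag_split by (auto simp: \<chi>_def p_def q_def intro!: sum.neutral)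
    finally show ?thesis .
  qed
  have combine: "x \<le> d + 2 * e" if "0 \<le> b - y + 2 * c" "b \<le> d" "c \<le> e" "x \<le> y"
    for x y b c d e :: real using that by linarith
  \<comment> \<open>Every term now carries the factor \<open>G\<close>, which is positive because
    \<open>A\<close> is nonempty, and can be divided by it.\<close>
  have main: "curv B * (n * (G * s) / 8) \<le> t * G + 2 * (2 * (W * G) + 2 * (n * \<bar>\<delta>r\<bar> * G))"
    by (rule combine[OF total noise cross mult_left_mono[OF coercive less_imp_le[OF curv_pos]]])
  obtain i0 where i0: "i0 \<in> A" using A(2) by blast
  have "0 < g i0" using s(1) s(2)[OF i0] i0 by (simp add: g_def p_def q_def)
  also have "g i0 \<le> G"
    unfolding G_def by (rule member_le_sum) (use i0 A(1) in \<open>auto simp: g_def\<close>)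
  finally have "0 < G" .
  moreover have "G * (curv B * n * s) \<le> G * (8 * (t + 4 * W + 4 * n * \<bar>\<delta>r\<bar>))"
    using main by (simp add: algebra_simps)
  ultimately show ?thesis unfolding W_def by (simp only: mult_le_cancel_left_pos)
qed

end

section \<open>From mean square to uniform errors\<close>

text \<open>The first summand comes from \<open>energy_bound\<close>, the second is the square of
  \<open>4 * B\<close> and pays for the diagonal terms missing there.\<close>

definition mse_const :: "real \<Rightarrow> real" where
  "mse_const B = 10 * B / curv B + 16 * B\<^sup>2"

text \<open>Up to slack, the right-hand side of \<open>displacement_bound\<close> relative to
  \<open>n * h\<close>, where \<open>h\<close> is the square root of \<open>t / n\<close>.\<close>

definition shift_const :: "real \<Rightarrow> real" where
  "shift_const B = 8 * (1 + 24 * sqrt (mse_const B))"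

definition error_const :: "real \<Rightarrow> real" where
  "error_const B = (shift_const B + 128 * shift_const B / curv B) / curv B"

context mle_concentrated
begin

lemma mean_square_bound:
  assumes t1: "1 \<le> t"
  obtains c where
    "(\<Sum>i\<in>{1..n}. (\<delta>a i + c)\<^sup>2 + (\<delta>b i - c)\<^sup>2) \<le> mse_const B * t" "\<delta>r\<^sup>2 \<le> 4 * mse_const B * t / n"
proof -
  let ?I = "{1..n}"
  \<comment> \<open>With this choice the \<open>v i\<close> sum to zero, so the cross term in the
    double sum of \<open>(u i + v j)^2\<close> vanishes and the mean squares of \<open>u\<close> and
    \<open>v\<close> separate.\<close>
  define c where "c = (\<Sum>j\<in>?I. \<delta>b j) / n"
  define u where "u i = \<delta>a i + c" for i
  define v where "v i = \<delta>b i - c" for i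
  define S where "S = (\<Sum>i\<in>?I. \<Sum>j\<in>?I - {i}. (\<delta>a i + \<delta>b j)\<^sup>2)"
  have n0: "0 < real n" using n_ge_2 by simp
  have "(\<Sum>i\<in>?I. \<Sum>j\<in>?I - {i}. (\<delta>a i + \<delta>b j)\<^sup>2 + \<delta>r\<^sup>2 / 2) = S + n * real (n - 1) * (\<delta>r\<^sup>2 / 2)"
    using n_ge_2 by (simp add: S_def sum.distrib of_nat_diff)
  then have "curv B * (S + n * real (n - 1) * (\<delta>r\<^sup>2 / 2)) \<le> 10 * B * n * t"
    using energy_bound by simp
  then have E: "S + n * real (n - 1) * (\<delta>r\<^sup>2 / 2) \<le> 10 * B / curv B * n * t"
    using curv_pos[of B] by (simp add: pos_le_divide_eq mult.commute)
  have S0: "0 \<le> S" by (auto simp: S_def intro!: sum_nonneg)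
  have sumv: "(\<Sum>j\<in>?I. v j) = 0"
    using n0 by (simp add: v_def c_def sum_subtractf)
  have "n * (\<Sum>i\<in>?I. (u i)\<^sup>2 + (v i)\<^sup>2)
     = (\<Sum>i\<in>?I. \<Sum>j\<in>?I. (u i)\<^sup>2) + (\<Sum>i\<in>?I. \<Sum>j\<in>?I. (v j)\<^sup>2) + 2 * ((\<Sum>i\<in>?I. u i) * (\<Sum>j\<in>?I. v j))"
    unfolding sumv by (simp add: sum.distrib sum_distrib_left distrib_left)
  also have "\<dots> = (\<Sum>i\<in>?I. \<Sum>j\<in>?I. (u i + v j)\<^sup>2)"
  proof -
    have "2 * ((\<Sum>i\<in>?I. u i) * (\<Sum>j\<in>?I. v j)) = (\<Sum>i\<in>?I. \<Sum>j\<in>?I. 2 * (u i * v j))"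
      unfolding sum_product by (simp only: sum_distrib_left)
    then show ?thesis by (simp only: sum.distrib[symmetric] power2_sum mult.assoc)
  qed
  also have "\<dots> = (\<Sum>i\<in>?I. \<Sum>j\<in>?I. (\<delta>a i + \<delta>b j)\<^sup>2)"
  proof -
    have "u i + v j = \<delta>a i + \<delta>b j" for i j by (simp add: u_def v_def)
    then show ?thesis by (simp only:)
  qed
  also have "\<dots> = S + (\<Sum>i\<in>?I. (\<delta>a i + \<delta>b i)\<^sup>2)"
    unfolding S_def by (rule sum_offdiag_split)
  \<comment> \<open>The diagonal is not controlled by the likelihood. Its trivial bound is of order
    \<open>n\<close> and is absorbed using \<open>1 \<le> t\<close>.\<close>
  also have "(\<Sum>i\<in>?I. (\<delta>a i + \<delta>b i)\<^sup>2) \<le> (\<Sum>i\<in>?I. (4 * B)\<^sup>2)"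
  proof (rule sum_mono)
    fix i assume i: "i \<in> ?I"
    have "\<bar>\<delta>a i + \<delta>b i\<bar> \<le> 4 * B"
      using param_space_bounds[OF true_in i] param_space_bounds[OF est_in i] by linarith
    then show "(\<delta>a i + \<delta>b i)\<^sup>2 \<le> (4 * B)\<^sup>2"
      using power_mono[of "\<bar>\<delta>a i + \<delta>b i\<bar>" "4 * B" 2] by simp
  qed
  also have "(\<Sum>i\<in>?I. (4 * B)\<^sup>2) \<le> 16 * B\<^sup>2 * n * t"
    using mult_left_mono[OF t1, of "16 * B\<^sup>2 * n"] by (simp add: power_mult_distrib mult.commute mult.left_commute)
  also have "S \<le> 10 * B / curv B * n * t"
    using E by (rule order_trans[rotated]) simp
  finally have "n * (\<Sum>i\<in>?I. (u i)\<^sup>2 + (v i)\<^sup>2) \<le> n * (mse_const B * t)"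
    by (simp add: mse_const_def algebra_simps)
  then have 1: "(\<Sum>i\<in>?I. (u i)\<^sup>2 + (v i)\<^sup>2) \<le> mse_const B * t"
    using n0 by (simp only: mult_le_cancel_left_pos)
  have "n / 2 \<le> real (n - 1)" using n_ge_2 by linarith
  then have "n * (n / 2) * (\<delta>r\<^sup>2 / 2) \<le> n * real (n - 1) * (\<delta>r\<^sup>2 / 2)"
    by (intro mult_right_mono mult_left_mono) auto
  also have "\<dots> \<le> 10 * B / curv B * n * t" using E S0 by simp
  also have "\<dots> \<le> n * (mse_const B * t)"
    using t1 by (simp add: mse_const_def algebra_simps)
  finally have "n * (n * \<delta>r\<^sup>2) \<le> n * (4 * mse_const B * t)" by (simp add: mult.assoc)
  then have "n * \<delta>r\<^sup>2 \<le> 4 * mse_const B * t" using n0 by (simp only: mult_le_cancel_left_pos)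
  then have "\<delta>r\<^sup>2 \<le> 4 * mse_const B * t / n" using n0 by (simp add: pos_le_divide_eq mult.commute)
  with 1 show ?thesis using that unfolding u_def v_def by blast
qed

text \<open>\<open>h\<close> is the square root of \<open>t / n\<close>. The mean-square bound and
  two uses of \<open>displacement_bound\<close> are combined: one with the bad nodes and
  \<open>\<kappa> = c\<close> to bound \<open>c\<close>, one with the single node \<open>k\<close>
  and \<open>\<kappa> = 0\<close>.\<close>

lemma error_bound:
  fixes h :: real
  assumes t: "1 \<le> t" "t = n * h\<^sup>2" and h: "0 < h" "h \<le> 1" and k: "k \<in> {1..n}"
  shows "\<bar>\<delta>a k\<bar> + \<bar>\<delta>b k\<bar> \<le> error_const B * h"
proof -
  let ?I = "{1..n}"
  obtain c where c: "(\<Sum>i\<in>?I. (\<delta>a i + c)\<^sup>2 + (\<delta>b i - c)\<^sup>2) \<le> mse_const B * t" "\<delta>r\<^sup>2 \<le> 4 * mse_const B * t / n"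
    using mean_square_bound[OF t(1)] by blast
  define u where "u i = \<delta>a i + c" for i
  define v where "v i = \<delta>b i - c" for i
  define W where "W = (\<Sum>i\<in>?I. \<bar>u i\<bar> + \<bar>v i\<bar>)"
  define s1 where "s1 = sqrt (mse_const B)"
  define L where "L = curv B"
  have n0: "0 < real n" using n_ge_2 by simp
  have L: "0 < L" "L \<le> 1" using curv_pos curv_le_1[OF B_pos] by (simp_all add: L_def)
  have C1: "0 < mse_const B" using B_pos curv_pos[of B] by (auto simp: mse_const_def intro!: add_pos_nonneg)
  have s1: "0 < s1" "s1\<^sup>2 = mse_const B" using C1 by (simp_all add: s1_def)
  have uv: "(\<Sum>i\<in>?I. (u i)\<^sup>2 + (v i)\<^sup>2) \<le> s1\<^sup>2 * (n * h\<^sup>2)"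
    using c(1) t(2) s1 by (simp add: u_def v_def)
  have "\<delta>r\<^sup>2 \<le> (2 * s1 * h)\<^sup>2"
    using c(2) t(2) s1 n0 by (simp add: power_mult_distrib)
  then have r: "\<bar>\<delta>r\<bar> \<le> 2 * s1 * h"
    using power2_le_imp_le[of "\<bar>\<delta>r\<bar>" "2 * s1 * h"] s1 h by simp
  \<comment> \<open>Cauchy-Schwarz turns the mean-square bound into a bound on the sum of absolute
    errors; the factor 4 below is not sharp but keeps the result a perfect square.\<close>
  have "W\<^sup>2 \<le> (\<Sum>i\<in>?I. (\<bar>u i\<bar> + \<bar>v i\<bar>)\<^sup>2) * n"
    unfolding W_def using sum_squared_le_sum_of_squares[of "\<lambda>i. \<bar>u i\<bar> + \<bar>v i\<bar>" ?I] by simp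
  also have "(\<Sum>i\<in>?I. (\<bar>u i\<bar> + \<bar>v i\<bar>)\<^sup>2) \<le> (\<Sum>i\<in>?I. 4 * ((u i)\<^sup>2 + (v i)\<^sup>2))"
  proof (rule sum_mono)
    fix i
    have "(\<bar>u i\<bar> + \<bar>v i\<bar>)\<^sup>2 \<le> 2 * ((u i)\<^sup>2 + (v i)\<^sup>2)"
      using sum_squares_bound[of "\<bar>u i\<bar>" "\<bar>v i\<bar>"] by (simp add: power2_sum)
    then show "(\<bar>u i\<bar> + \<bar>v i\<bar>)\<^sup>2 \<le> 4 * ((u i)\<^sup>2 + (v i)\<^sup>2)"
      by (rule order_trans) simp
  qed
  also have "\<dots> = 4 * (\<Sum>i\<in>?I. (u i)\<^sup>2 + (v i)\<^sup>2)" by (simp only: sum_distrib_left)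
  also have "\<dots> * n \<le> 4 * (s1\<^sup>2 * (n * h\<^sup>2)) * n"
    using uv by (intro mult_right_mono mult_left_mono) auto
  also have "\<dots> = (2 * s1 * (n * h))\<^sup>2" by (simp add: power2_eq_square)
  finally have W: "W \<le> 2 * s1 * (n * h)"
    using s1 h n0 by (intro power2_le_imp_le[of W]) auto
  have tn: "t \<le> n * h"
    using t(2) h n0 by (simp add: power2_eq_square mult_le_one)
  have C2: "shift_const B = 8 * (1 + 24 * s1)" by (simp add: shift_const_def s1_def)
  have base: "8 * (t + 4 * W + 4 * n * \<bar>\<delta>r\<bar>) \<le> shift_const B * (n * h)"
  proof -
    have "n * \<bar>\<delta>r\<bar> \<le> n * (2 * s1 * h)" using r n0 by (intro mult_left_mono) auto
    with tn W have "8 * (t + 4 * W + 4 * n * \<bar>\<delta>r\<bar>) \<le> 8 * (n * h) + 128 * s1 * (n * h)"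
      by (simp add: algebra_simps)
    also have "\<dots> \<le> shift_const B * (n * h)" using s1 h n0 by (simp add: C2 distrib_right)
    finally show ?thesis .
  qed
  have gauge: "L * \<bar>c\<bar> \<le> 2 * shift_const B * h"
  proof (cases "c = 0")
    case True
    then show ?thesis using h s1 by (simp add: C2)
  next
    case False
    \<comment> \<open>The bad nodes, whose errors exceed half the shift.\<close>
    define A where "A = {i\<in>?I. \<bar>c\<bar> / 2 < \<bar>u i\<bar> \<or> \<bar>c\<bar> / 2 < \<bar>v i\<bar>}"
    have A: "A \<subseteq> ?I" "finite A" by (auto simp: A_def)
    show ?thesis
    proof (cases "2 * card A \<le> n")
      case True
      \<comment> \<open>The normalization of truth and estimator gives \<open>u 1 = c\<close>, so
        node 1 is bad.\<close>
      have one: "1 \<in> A"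
        using False n_ge_2 true_in est_in by (auto simp: A_def u_def param_space_def)
      have "\<bar>\<alpha>h i + c / 2\<bar> \<le> B \<and> \<bar>\<beta>h i - c / 2\<bar> \<le> B" if i: "i \<in> ?I - A" for i
      proof -
        have iI: "i \<in> ?I" using i by simp
        have small: "\<bar>u i\<bar> \<le> \<bar>c\<bar> / 2" "\<bar>v i\<bar> \<le> \<bar>c\<bar> / 2" using i by (auto simp: A_def)
        \<comment> \<open>For a good node \<open>x - y\<close> is within
          \<open>\<bar>d\<bar> / 2\<close> of \<open>- d\<close>, so moving the estimate
          \<open>x\<close> by \<open>d / 2\<close> stays between \<open>x\<close> and the true value
          \<open>y\<close>, both of which are in the box.\<close>
        have "\<bar>x + d / 2\<bar> \<le> B" if "\<bar>x\<bar> \<le> B" "\<bar>y\<bar> \<le> B" "\<bar>x - y + d\<bar> \<le> \<bar>d\<bar> / 2" for x y d :: real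
          using that by linarith
        from this[of "\<alpha>h i" "\<alpha>s i" c] this[of "\<beta>h i" "\<beta>s i" "- c"] show ?thesis
          using small param_space_bounds[OF true_in iI] param_space_bounds[OF est_in iI]
          by (simp add: u_def v_def)
      qed
      note feasible = this
      have "curv B * n * (\<bar>c\<bar> / 2) \<le> 8 * (t + 4 * W + 4 * n * \<bar>\<delta>r\<bar>)"
        unfolding W_def u_def v_def
      proof (rule displacement_bound[OF A(1) _ True _ feasible])
        show "A \<noteq> {}" "1 \<in> A \<or> c = 0" using one by auto
        show "0 < \<bar>c\<bar> / 2" using False by simp
        show "\<bar>c\<bar> / 2 \<le> \<bar>\<delta>a i + c\<bar> + \<bar>\<delta>b i - c\<bar>" if "i \<in> A" for i
          using that abs_ge_zero[of "u i"] abs_ge_zero[of "v i"] unfolding A_def u_def v_def mem_Collect_eq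
          by linarith
      qed
      with base have "n * (L * \<bar>c\<bar>) \<le> n * (2 * shift_const B * h)"
        by (simp add: L_def algebra_simps)
      then show ?thesis using n0 by (simp only: mult_le_cancel_left_pos)
    next
      \<comment> \<open>If more than half of the nodes are bad, the mean-square bound alone forces
        \<open>c^2 \<le> 8 * s1^2 * h^2\<close>.\<close>
      case F: False
      have "(c / 2)\<^sup>2 \<le> (u i)\<^sup>2 + (v i)\<^sup>2" if "i \<in> A" for i
      proof -
        have "\<bar>c / 2\<bar> \<le> \<bar>u i\<bar> \<or> \<bar>c / 2\<bar> \<le> \<bar>v i\<bar>" using that by (auto simp: A_def)
        then have "(c / 2)\<^sup>2 \<le> (u i)\<^sup>2 \<or> (c / 2)\<^sup>2 \<le> (v i)\<^sup>2" by (simp only: abs_le_square_iff)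
        then show ?thesis using zero_le_power2[of "u i"] zero_le_power2[of "v i"] by linarith
      qed
      then have "card A * (c / 2)\<^sup>2 \<le> (\<Sum>i\<in>A. (u i)\<^sup>2 + (v i)\<^sup>2)"
        using sum_mono[of A "\<lambda>_. (c / 2)\<^sup>2"] by simp
      also have "\<dots> \<le> (\<Sum>i\<in>?I. (u i)\<^sup>2 + (v i)\<^sup>2)"
        using A by (intro sum_mono2) auto
      also note uv
      finally have "card A * (c / 2)\<^sup>2 \<le> n * (s1\<^sup>2 * h\<^sup>2)" by (simp add: mult_ac)
      moreover have "n / 2 * (c / 2)\<^sup>2 \<le> card A * (c / 2)\<^sup>2"
        using F by (intro mult_right_mono) auto
      ultimately have "n * (c\<^sup>2 / 8) \<le> n * (s1\<^sup>2 * h\<^sup>2)" by (simp add: power_divide)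
      then have "c\<^sup>2 / 8 \<le> s1\<^sup>2 * h\<^sup>2" using n0 by (simp only: mult_le_cancel_left_pos)
      then have "\<bar>c\<bar>\<^sup>2 \<le> (3 * s1 * h)\<^sup>2"
      proof -
        have "0 \<le> s1\<^sup>2 * h\<^sup>2" by simp
        with \<open>c\<^sup>2 / 8 \<le> s1\<^sup>2 * h\<^sup>2\<close> have "c\<^sup>2 \<le> 9 * (s1\<^sup>2 * h\<^sup>2)" by linarith
        then show ?thesis by (simp add: power_mult_distrib)
      qed
      then have "\<bar>c\<bar> \<le> 3 * s1 * h" by (rule power2_le_imp_le) (use s1 h in simp)
      also have "\<dots> \<le> 2 * shift_const B * h" using s1 h by (intro mult_right_mono) (auto simp: C2)
      finally show ?thesis using mult_right_mono[OF L(2), of "\<bar>c\<bar>"] by simp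
    qed
  qed
  \<comment> \<open>Undoing the shift costs at most \<open>2 * \<bar>c\<bar>\<close> per node, which
    is affordable now that \<open>c\<close> is bounded.\<close>
  define W0 where "W0 = (\<Sum>i\<in>?I. \<bar>\<delta>a i\<bar> + \<bar>\<delta>b i\<bar>)"
  have "W0 \<le> (\<Sum>i\<in>?I. \<bar>u i\<bar> + \<bar>v i\<bar> + 2 * \<bar>c\<bar>)"
    unfolding W0_def u_def v_def by (intro sum_mono) linarith
  also have "\<dots> = W + 2 * n * \<bar>c\<bar>" by (simp add: W_def sum.distrib)
  finally have W0: "W0 \<le> W + 2 * n * \<bar>c\<bar>" .
  have C2pos: "0 < shift_const B" using s1 by (simp add: C2)
  show ?thesis
  proof (cases "\<bar>\<delta>a k\<bar> + \<bar>\<delta>b k\<bar> = 0")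
    case True
    moreover have "0 \<le> error_const B * h" using C2pos L h by (simp add: error_const_def L_def[symmetric])
    ultimately show ?thesis by simp
  next
    case False
    \<comment> \<open>Only node \<open>k\<close> moves, and \<open>s\<close> is its own error;
      positivity of \<open>s\<close> is why a zero error is treated separately.\<close>
    have "curv B * n * (\<bar>\<delta>a k\<bar> + \<bar>\<delta>b k\<bar>) \<le> 8 * (t + 4 * (\<Sum>i\<in>?I. \<bar>\<delta>a i + 0\<bar> + \<bar>\<delta>b i - 0\<bar>) + 4 * n * \<bar>\<delta>r\<bar>)"
    proof (rule displacement_bound[of "{k}"])
      show "\<bar>\<alpha>h i + 0 / 2\<bar> \<le> B \<and> \<bar>\<beta>h i - 0 / 2\<bar> \<le> B" if "i \<in> ?I - {k}" for i
        using param_space_bounds[OF est_in, of i] that by simp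
      show "0 < \<bar>\<delta>a k\<bar> + \<bar>\<delta>b k\<bar>" using False by linarith
    qed (use k n_ge_2 in auto)
    also have "\<dots> \<le> 8 * (t + 4 * W + 4 * n * \<bar>\<delta>r\<bar>) + 64 * n * \<bar>c\<bar>"
      using W0 by (simp add: W0_def)
    also have "\<dots> \<le> shift_const B * (n * h) + 64 * n * (2 * shift_const B * h / L)"
      using base gauge L n0 by (intro add_mono mult_left_mono) (auto simp: pos_le_divide_eq mult.commute)
    also have "\<dots> = n * ((shift_const B + 128 * shift_const B / L) * h)" by (simp add: algebra_simps)
    finally have "n * (L * (\<bar>\<delta>a k\<bar> + \<bar>\<delta>b k\<bar>)) \<le> n * ((shift_const B + 128 * shift_const B / L) * h)"
      by (simp add: L_def mult_ac)
    then have "L * (\<bar>\<delta>a k\<bar> + \<bar>\<delta>b k\<bar>) \<le> (shift_const B + 128 * shift_const B / L) * h"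
      using n0 by (simp only: mult_le_cancel_left_pos)
    then show ?thesis
      using L by (simp add: error_const_def L_def[symmetric] pos_le_divide_eq mult.commute)
  qed
qed

end

section \<open>Concentration of the noise\<close>

lemma bool_pair_sum:
  fixes F :: "bool \<Rightarrow> bool \<Rightarrow> real"
  shows "(\<Sum>x\<in>UNIV. \<Sum>y\<in>UNIV. F x y) = F True True + F True False + F False True + F False False"
  by (simp add: UNIV_bool)

text \<open>Independence of the dyads: a graph amounts to a free choice of one outcome per dyad
  (\<open>\<Phi>\<close> with inverse \<open>\<Psi>\<close>), so the sum over graphs distributes
  over the product.\<close>

lemma sum_graphs_prod:
  fixes F :: "nat \<Rightarrow> nat \<Rightarrow> bool \<Rightarrow> bool \<Rightarrow> real"
  shows "(\<Sum>a\<in>graphs n. \<Prod>(i, j)\<in>pairs n. F i j (a i j) (a j i))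
    = (\<Prod>(i, j)\<in>pairs n. \<Sum>x\<in>UNIV. \<Sum>y\<in>UNIV. F i j x y)"
proof -
  define \<Phi> :: "(nat \<Rightarrow> nat \<Rightarrow> bool) \<Rightarrow> nat \<times> nat \<Rightarrow> bool \<times> bool"
    where "\<Phi> a = restrict (\<lambda>(i, j). (a i j, a j i)) (pairs n)" for a
  define \<Psi> :: "(nat \<times> nat \<Rightarrow> bool \<times> bool) \<Rightarrow> nat \<Rightarrow> nat \<Rightarrow> bool"
    where "\<Psi> x i j = (if (i, j) \<in> pairs n then fst (x (i, j)) else if (j, i) \<in> pairs n then snd (x (j, i)) else False)"
    for x i j
  have bij: "bij_betw \<Phi> (graphs n) (Pi\<^sub>E (pairs n) (\<lambda>_. UNIV))"
  proof (rule bij_betw_byWitness[where f' = \<Psi>])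
    show "\<forall>a\<in>graphs n. \<Psi> (\<Phi> a) = a"
      by (auto simp: \<Phi>_def \<Psi>_def graphs_def pairs_def fun_eq_iff)
        (metis linorder_neqE_nat)+
    show "\<forall>x\<in>Pi\<^sub>E (pairs n) (\<lambda>_. UNIV). \<Phi> (\<Psi> x) = x"
      by (auto simp: \<Phi>_def \<Psi>_def pairs_def PiE_def extensional_def restrict_def fun_eq_iff)
    show "\<Phi> ` graphs n \<subseteq> Pi\<^sub>E (pairs n) (\<lambda>_. UNIV)"
      by (auto simp: \<Phi>_def)
    show "\<Psi> ` Pi\<^sub>E (pairs n) (\<lambda>_. UNIV) \<subseteq> graphs n"
      by (auto simp: \<Psi>_def graphs_def pairs_def split: if_splits)
  qed
  have "(\<Prod>(i, j)\<in>pairs n. \<Sum>x\<in>UNIV. \<Sum>y\<in>UNIV. F i j x y)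
      = (\<Prod>p\<in>pairs n. \<Sum>z\<in>UNIV. F (fst p) (snd p) (fst z) (snd z))"
    by (simp add: case_prod_unfold sum.cartesian_product UNIV_Times_UNIV[symmetric] del: UNIV_Times_UNIV)
  also have "\<dots> = (\<Sum>x\<in>Pi\<^sub>E (pairs n) (\<lambda>_. UNIV). \<Prod>p\<in>pairs n. F (fst p) (snd p) (fst (x p)) (snd (x p)))"
    by (rule prod_sum_PiE) auto
  also have "\<dots> = (\<Sum>a\<in>graphs n. \<Prod>p\<in>pairs n. F (fst p) (snd p) (fst (\<Phi> a p)) (snd (\<Phi> a p)))"
    by (rule sum.reindex_bij_betw[OF bij, symmetric])
  also have "\<dots> = (\<Sum>a\<in>graphs n. \<Prod>(i, j)\<in>pairs n. F i j (a i j) (a j i))"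
    by (intro sum.cong prod.cong refl) (auto simp: \<Phi>_def)
  finally show ?thesis ..
qed

lemma finite_graphs: "finite (graphs n)"
proof (rule finite_subset)
  let ?f = "\<lambda>E i j. (i, j) \<in> E"
  show "graphs n \<subseteq> ?f ` Pow ({1..n} \<times> {1..n})"
  proof
    fix a assume a: "a \<in> graphs n"
    have "a = ?f {(i, j). a i j}" by simp
    moreover have "{(i, j). a i j} \<in> Pow ({1..n} \<times> {1..n})" using a by (auto simp: graphs_def)
    ultimately show "a \<in> ?f ` Pow ({1..n} \<times> {1..n})" by (rule image_eqI)
  qed
qed auto

text \<open>For negative \<open>z\<close> put \<open>x = - z\<close>: the claim follows from
  \<open>(1 - x + x^2) * (1 + x) = 1 + x^3\<close> and \<open>1 + x \<le> exp x\<close>.\<close>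

lemma exp_le_quadratic:
  fixes z :: real
  assumes "\<bar>z\<bar> \<le> 1"
  shows "exp z \<le> 1 + z + z\<^sup>2"
proof (cases "0 \<le> z")
  case True
  then show ?thesis using exp_bound[of z] assms by simp
next
  case False
  define x where "x = - z"
  have x: "0 < x" using False by (simp add: x_def)
  have "1 \<le> 1 + x ^ 3" using x by simp
  also have "\<dots> = (1 - x + x\<^sup>2) * (1 + x)" by (simp add: power2_eq_square power3_eq_cube algebra_simps)
  also have "\<dots> \<le> (1 - x + x\<^sup>2) * exp x"
  proof (rule mult_left_mono)
    show "0 \<le> 1 - x + x\<^sup>2" using assms by (simp add: x_def)
  qed (rule exp_ge_add_one_self)
  finally have "1 / exp x \<le> 1 - x + x\<^sup>2" by (simp add: divide_le_eq)
  then show ?thesis by (simp add: x_def exp_minus field_simps)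
qed

text \<open>Statistics of a dyad as seen from its node \<open>i\<close>, with \<open>x\<close> the
  edge out of \<open>i\<close> and \<open>y\<close> the edge into \<open>i\<close>. All ordered
  index pairs are covered, so a node may be the smaller or the larger end of its dyads.\<close>

definition dyad_centered :: "(nat \<Rightarrow> real) \<Rightarrow> (nat \<Rightarrow> real) \<Rightarrow> real \<Rightarrow> (nat \<Rightarrow> nat \<Rightarrow> bool \<Rightarrow> bool \<Rightarrow> real) \<Rightarrow> bool" where
  "dyad_centered \<alpha> \<beta> \<rho> h \<longleftrightarrow> (\<forall>i j x y. \<bar>h i j x y\<bar> \<le> 1) \<and>
     (\<forall>i j. (\<Sum>x\<in>UNIV. \<Sum>y\<in>UNIV. dyad_q x y (\<alpha> i + \<beta> j) (\<beta> i + \<alpha> j) \<rho> * h i j x y) = 0)"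

lemma dyad_q_swap: "dyad_q y x r2 r1 \<rho> = dyad_q x y r1 r2 \<rho>"
  by (simp add: dyad_q_def algebra_simps)

text \<open>Taking expectations in the quadratic bound for \<open>exp\<close> removes the linear
  term and leaves \<open>1 + l^2\<close>.\<close>

lemma mgf_bound:
  fixes g h :: "bool \<Rightarrow> bool \<Rightarrow> real"
  assumes g: "\<And>x y. 0 \<le> g x y" "(\<Sum>x\<in>UNIV. \<Sum>y\<in>UNIV. g x y) = 1"
    and h: "\<And>x y. \<bar>h x y\<bar> \<le> 1" "(\<Sum>x\<in>UNIV. \<Sum>y\<in>UNIV. g x y * h x y) = 0"
    and l: "0 \<le> l" "l \<le> 1"
  shows "(\<Sum>x\<in>UNIV. \<Sum>y\<in>UNIV. g x y * exp (l * h x y)) \<le> exp (l\<^sup>2)"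
proof -
  have "g x y * exp (l * h x y) \<le> g x y + l * (g x y * h x y) + l\<^sup>2 * g x y" for x y
  proof -
    have "\<bar>l * h x y\<bar> \<le> 1" using l h(1)[of x y] by (simp add: abs_mult mult_le_one)
    then have "exp (l * h x y) \<le> 1 + l * h x y + (l * h x y)\<^sup>2" by (rule exp_le_quadratic)
    also have "(l * h x y)\<^sup>2 \<le> l\<^sup>2"
      using h(1)[of x y] by (simp add: power_mult_distrib abs_square_le_1 mult_left_le)
    finally have "g x y * exp (l * h x y) \<le> g x y * (1 + l * h x y + l\<^sup>2)"
      by (intro mult_left_mono g) simp
    then show ?thesis by (simp add: algebra_simps)
  qed
  then have "(\<Sum>x\<in>UNIV. \<Sum>y\<in>UNIV. g x y * exp (l * h x y))
      \<le> (\<Sum>x\<in>UNIV. \<Sum>y\<in>UNIV. g x y + l * (g x y * h x y) + l\<^sup>2 * g x y)"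
    by (intro sum_mono)
  also have "\<dots> = 1 + l\<^sup>2"
    using g(2) h(2) by (simp add: sum.distrib sum_distrib_left[symmetric])
  also have "\<dots> \<le> exp (l\<^sup>2)" by (rule exp_ge_add_one_self)
  finally show ?thesis .
qed

text \<open>The moment generating function factors over dyads. Dyads away from node \<open>i\<close>
  contribute 1; each of the at most \<open>n\<close> others contributes at most
  \<open>exp (l^2)\<close>.\<close>

lemma node_mgf_bound:
  assumes h: "dyad_centered \<alpha> \<beta> \<rho> h" and l: "0 \<le> l" "l \<le> 1" and i: "i \<in> {1..n}"
  shows "(\<Sum>a\<in>graphs n. graph_prob n \<alpha> \<beta> \<rho> a * exp (l * (\<Sum>j\<in>{1..n} - {i}. h i j (a i j) (a j i))))
     \<le> exp (l\<^sup>2 * n)"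
proof -
  \<comment> \<open>The node sum rewritten over increasing pairs: if \<open>i\<close> is the larger
    end, the two outcomes are exchanged. \<open>E\<close> lists the dyads of \<open>i\<close> in
    increasing order, together with the harmless pair \<open>(i, i)\<close>.\<close>
  define f where "f k m x y = (if k = i then h k m x y else 0) + (if m = i then h m k y x else 0)" for k m x y
  define g where "g k m x y = dyad_q x y (\<alpha> k + \<beta> m) (\<beta> k + \<alpha> m) \<rho>" for k m x y
  define E where "E = (\<lambda>j. (min i j, max i j)) ` {1..n}"
  have node_sum: "(\<Sum>j\<in>{1..n} - {i}. h i j (a i j) (a j i)) = (\<Sum>(k, m)\<in>pairs n. f k m (a k m) (a m k))" for a
  proof -
    have "(\<Sum>(k, m)\<in>pairs n. f k m (a k m) (a m k))
        = (\<Sum>k\<in>{1..n}. \<Sum>m\<in>{1..n} - {k}. if k = i then h k m (a k m) (a m k) else 0)"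
      unfolding f_def by (rule sum_pairs_symmetrize)
    also have "\<dots> = (\<Sum>k\<in>{1..n}. if k = i then \<Sum>m\<in>{1..n} - {k}. h k m (a k m) (a m k) else 0)"
      by (intro sum.cong refl) auto
    also have "\<dots> = (\<Sum>j\<in>{1..n} - {i}. h i j (a i j) (a j i))" using i by simp
    finally show ?thesis ..
  qed
  have factor: "(\<Sum>x\<in>UNIV. \<Sum>y\<in>UNIV. g k m x y * exp (l * f k m x y)) \<le> (if (k, m) \<in> E then exp (l\<^sup>2) else 1)"
    if km: "(k, m) \<in> pairs n" for k m
  proof -
    have g1: "0 \<le> g k m x y" "(\<Sum>x\<in>UNIV. \<Sum>y\<in>UNIV. g k m x y) = 1" for x y
      using dyad_q_sum by (simp_all add: g_def less_imp_le[OF dyad_q_pos] bool_pair_sum)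
    have neq: "k \<noteq> m" using km by (auto simp: pairs_def)
    show ?thesis
    proof (cases "k = i \<or> m = i")
      case True
      have "\<bar>f k m x y\<bar> \<le> 1" for x y
        using h neq True by (auto simp: f_def dyad_centered_def)
      moreover have "(\<Sum>x\<in>UNIV. \<Sum>y\<in>UNIV. g k m x y * f k m x y) = 0"
      proof (cases "k = i")
        case True
        then show ?thesis using h neq by (simp add: f_def g_def dyad_centered_def)
      next
        case False
        \<comment> \<open>Centring is known in the orientation starting at \<open>m = i\<close>;
          exchanging outcomes and parameters together leaves the dyad law unchanged.\<close>
        have "(\<Sum>x\<in>UNIV. \<Sum>y\<in>UNIV. dyad_q x y (\<alpha> m + \<beta> k) (\<beta> m + \<alpha> k) \<rho> * h m k x y) = 0"
          using h by (simp add: dyad_centered_def)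
        then show ?thesis
          using False \<open>k = i \<or> m = i\<close> dyad_q_swap[of _ _ "\<alpha> m + \<beta> k" "\<beta> m + \<alpha> k" \<rho>]
          by (simp add: f_def g_def bool_pair_sum add.commute)
      qed
      ultimately have "(\<Sum>x\<in>UNIV. \<Sum>y\<in>UNIV. g k m x y * exp (l * f k m x y)) \<le> exp (l\<^sup>2)"
        using g1 l by (intro mgf_bound) auto
      moreover have "(k, m) \<in> E"
      proof (cases "k = i")
        case True
        then show ?thesis using km unfolding E_def by (intro image_eqI[of _ _ m]) (auto simp: pairs_def)
      next
        case False
        then show ?thesis
          using km \<open>k = i \<or> m = i\<close> unfolding E_def by (intro image_eqI[of _ _ k]) (auto simp: pairs_def)
      qed
      ultimately show ?thesis by simp
    next
      case False
      then show ?thesis using g1(2) by (simp add: f_def)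
    qed
  qed
  have "(\<Sum>a\<in>graphs n. graph_prob n \<alpha> \<beta> \<rho> a * exp (l * (\<Sum>j\<in>{1..n} - {i}. h i j (a i j) (a j i))))
      = (\<Sum>a\<in>graphs n. \<Prod>(k, m)\<in>pairs n. g k m (a k m) (a m k) * exp (l * f k m (a k m) (a m k)))"
    unfolding node_sum graph_prob_def dyad_g_eq g_def
    by (simp add: sum_distrib_left exp_sum prod.distrib case_prod_unfold)
  also have "\<dots> = (\<Prod>(k, m)\<in>pairs n. \<Sum>x\<in>UNIV. \<Sum>y\<in>UNIV. g k m x y * exp (l * f k m x y))"
    by (rule sum_graphs_prod)
  also have "\<dots> \<le> (\<Prod>p\<in>pairs n. if p \<in> E then exp (l\<^sup>2) else 1)"
  proof (intro prod_mono conjI)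
    fix p assume p: "p \<in> pairs n"
    show "0 \<le> (case p of (k, m) \<Rightarrow> \<Sum>x\<in>UNIV. \<Sum>y\<in>UNIV. g k m x y * exp (l * f k m x y))"
      by (auto intro!: sum_nonneg mult_nonneg_nonneg simp: g_def less_imp_le[OF dyad_q_pos] split: prod.split)
    show "(case p of (k, m) \<Rightarrow> \<Sum>x\<in>UNIV. \<Sum>y\<in>UNIV. g k m x y * exp (l * f k m x y))
        \<le> (if p \<in> E then exp (l\<^sup>2) else 1)"
      using factor[of "fst p" "snd p"] p by (simp only: case_prod_unfold prod.collapse)
  qed
  also have "\<dots> = exp (l\<^sup>2) ^ card (pairs n \<inter> E)"
    by (simp add: prod.If_cases)
  also have "\<dots> \<le> exp (l\<^sup>2) ^ n"
  proof (rule power_increasing)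
    have "card (pairs n \<inter> E) \<le> card E" by (intro card_mono) (auto simp: E_def)
    also have "\<dots> \<le> n" using card_image_le[of "{1..n}" "\<lambda>j. (min i j, max i j)"] by (simp add: E_def)
    finally show "card (pairs n \<inter> E) \<le> n" .
  qed simp
  also have "\<dots> = exp (l\<^sup>2 * n)" by (simp add: exp_of_nat_mult[symmetric] mult.commute)
  finally show ?thesis .
qed

section \<open>From exponential moments to tail probabilities\<close>

lemma graph_prob_nonneg: "0 \<le> graph_prob n \<alpha> \<beta> \<rho> a"
  unfolding graph_prob_def dyad_g_eq by (intro prod_nonneg) (auto intro: less_imp_le[OF dyad_q_pos])

lemma model_prob_union_bound:
  assumes t: "0 \<le> t" "t \<le> 2 * n" and n: "0 < n"
    and H: "finite H" "\<And>h. h \<in> H \<Longrightarrow> dyad_centered \<alpha> \<beta> \<rho> h"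
    and S: "\<And>a. a \<in> graphs n \<inter> S \<Longrightarrow> \<exists>i\<in>{1..n}. \<exists>h\<in>H. t < (\<Sum>j\<in>{1..n} - {i}. h i j (a i j) (a j i))"
  shows "model_prob n \<alpha> \<beta> \<rho> S \<le> card H * n * exp (- (t\<^sup>2 / (4 * n)))"
proof -
  \<comment> \<open>The minimizer of \<open>l^2 * n - l * t\<close>; the hypothesis
    \<open>t \<le> 2 * n\<close> keeps it at most 1.\<close>
  define l where "l = t / (2 * n)"
  have l: "0 \<le> l" "l \<le> 1" using t n by (simp_all add: l_def)
  define Z where "Z h i a = (\<Sum>j\<in>{1..n} - {i}. h i j (a i j) (a j i))"
    for h :: "nat \<Rightarrow> nat \<Rightarrow> bool \<Rightarrow> bool \<Rightarrow> real" and i a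
  \<comment> \<open>Markov's inequality and the union bound in one step: on the event, this sum of
    exponentials dominates 1.\<close>
  have one: "1 \<le> (\<Sum>i\<in>{1..n}. \<Sum>h\<in>H. exp (l * (Z h i a - t)))" if "a \<in> graphs n \<inter> S" for a
  proof -
    from S[OF that] obtain i h where ih: "i \<in> {1..n}" "h \<in> H" "t < Z h i a"
      unfolding Z_def by blast
    have "1 \<le> exp (l * (Z h i a - t))" using l ih(3) by simp
    also have "\<dots> \<le> (\<Sum>h\<in>H. exp (l * (Z h i a - t)))"
      by (rule member_le_sum) (use ih H in auto)
    also have "\<dots> \<le> (\<Sum>i\<in>{1..n}. \<Sum>h\<in>H. exp (l * (Z h i a - t)))"
      by (rule member_le_sum[of i "{1..n}" "\<lambda>i. \<Sum>h\<in>H. exp (l * (Z h i a - t))"])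
        (use ih in \<open>auto intro: sum_nonneg\<close>)
    finally show ?thesis .
  qed
  have "model_prob n \<alpha> \<beta> \<rho> S \<le> (\<Sum>a\<in>graphs n \<inter> S. graph_prob n \<alpha> \<beta> \<rho> a * (\<Sum>i\<in>{1..n}. \<Sum>h\<in>H. exp (l * (Z h i a - t))))"
    unfolding model_prob_def using mult_left_mono[OF one graph_prob_nonneg] by (intro sum_mono) fastforce
  also have "\<dots> \<le> (\<Sum>a\<in>graphs n. graph_prob n \<alpha> \<beta> \<rho> a * (\<Sum>i\<in>{1..n}. \<Sum>h\<in>H. exp (l * (Z h i a - t))))"
    by (intro sum_mono2 finite_graphs) (auto intro!: mult_nonneg_nonneg graph_prob_nonneg sum_nonneg)
  also have "\<dots> = (\<Sum>i\<in>{1..n}. \<Sum>h\<in>H. (\<Sum>a\<in>graphs n. graph_prob n \<alpha> \<beta> \<rho> a * exp (l * Z h i a)) * exp (- (l * t)))"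
  proof -
    have "graph_prob n \<alpha> \<beta> \<rho> a * exp (l * (Z h i a - t)) = graph_prob n \<alpha> \<beta> \<rho> a * exp (l * Z h i a) * exp (- (l * t))" for a h i
      by (simp add: right_diff_distrib exp_diff exp_minus divide_inverse)
    note split_exp = this
    show ?thesis
      unfolding sum_distrib_left sum_distrib_right
      by (subst sum.swap, intro sum.cong refl, subst sum.swap) (simp only: split_exp)
  qed
  also have "\<dots> \<le> (\<Sum>i\<in>{1..n}. \<Sum>h\<in>H. exp (l\<^sup>2 * n) * exp (- (l * t)))"
    unfolding Z_def by (intro sum_mono mult_right_mono node_mgf_bound H l) auto
  also have "\<dots> = card H * n * exp (l\<^sup>2 * n - l * t)"
    by (simp add: exp_diff exp_minus divide_inverse)
  also have "l\<^sup>2 * n - l * t = - (t\<^sup>2 / (4 * n))"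
    using n by (simp add: l_def power2_eq_square field_simps)
  finally show ?thesis by simp
qed

lemma mean_bounds: "0 \<le> mean_out x y r" "mean_out x y r \<le> 1" "0 \<le> mean_rec x y r" "mean_rec x y r \<le> 1"
  using dyad_q_sum[of x y r] dyad_q_pos[of True True x y r] dyad_q_pos[of True False x y r]
    dyad_q_pos[of False True x y r] dyad_q_pos[of False False x y r]
  unfolding mean_out_def mean_rec_def by linarith+

lemma dyad_centered_uminus:
  "dyad_centered \<alpha> \<beta> \<rho> h \<Longrightarrow> dyad_centered \<alpha> \<beta> \<rho> (\<lambda>i j x y. - h i j x y)"
  by (simp add: dyad_centered_def sum_negf)

lemma dyad_centered_out:
  "dyad_centered \<alpha> \<beta> \<rho> (\<lambda>i j x y. ind x - mean_out (\<alpha> i + \<beta> j) (\<beta> i + \<alpha> j) \<rho>)"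
  (is ?out)
  and dyad_centered_in:
  "dyad_centered \<alpha> \<beta> \<rho> (\<lambda>i j x y. ind y - mean_out (\<beta> i + \<alpha> j) (\<alpha> i + \<beta> j) \<rho>)"
  (is ?in)
  and dyad_centered_rec:
  "dyad_centered \<alpha> \<beta> \<rho> (\<lambda>i j x y. ind x * ind y - mean_rec (\<alpha> i + \<beta> j) (\<beta> i + \<alpha> j) \<rho>)"
  (is ?rec)
proof -
  have bd: "\<bar>ind x - p\<bar> \<le> 1" "\<bar>ind x * ind y - p\<bar> \<le> 1" if "0 \<le> p" "p \<le> 1" for x y p
    using that by (auto simp: ind_def)
  have center: "(\<Sum>x\<in>UNIV. \<Sum>y\<in>UNIV. dyad_q x y u v r * (f x y - m)) = 0"
    if "m = (\<Sum>x\<in>UNIV. \<Sum>y\<in>UNIV. dyad_q x y u v r * f x y)" for u v r m f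
  proof -
    have "(\<Sum>x\<in>UNIV. \<Sum>y\<in>UNIV. dyad_q x y u v r * (f x y - m)) =
       (\<Sum>x\<in>UNIV. \<Sum>y\<in>UNIV. dyad_q x y u v r * f x y) - m * (\<Sum>x\<in>UNIV. \<Sum>y\<in>UNIV. dyad_q x y u v r)"
      by (simp add: bool_pair_sum algebra_simps)
    then show ?thesis using that dyad_q_sum[of u v r] by (simp add: bool_pair_sum)
  qed
  show ?out unfolding dyad_centered_def
    by (intro conjI allI bd mean_bounds center) (simp add: bool_pair_sum mean_out_def ind_def)
  show ?in unfolding dyad_centered_def
    by (intro conjI allI bd mean_bounds center) (simp add: bool_pair_sum mean_out_swap ind_def)
  show ?rec unfolding dyad_centered_def
    by (intro conjI allI bd mean_bounds center) (simp add: bool_pair_sum mean_rec_def ind_def)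
qed

section \<open>The rate\<close>

text \<open>With \<open>t = n * h^2\<close>, a large error forces some noise sum to exceed
  \<open>t\<close>; otherwise \<open>error_bound\<close> applies. It bounds each of the two sup
  distances separately, whence the factor 2.\<close>

lemma model_prob_error_le:
  assumes B_pos: "B > 0" and n: "2 \<le> n"
    and true_in: "(\<alpha>s, \<beta>s, \<rho>s) \<in> param_space n B"
    and est_mle: "\<And>a. a \<in> graphs n \<Longrightarrow>
         est a \<in> param_space n B \<and>
         (\<forall>(\<alpha>, \<beta>, \<rho>) \<in> param_space n B.
            loglik n a \<alpha> \<beta> \<rho> \<le> loglik n a (fst (est a)) (fst (snd (est a))) (snd (snd (est a))))"
    and h: "0 < h" "h \<le> 1" "1 \<le> n * h\<^sup>2"
  shows "model_prob n \<alpha>s \<beta>s \<rho>s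
      {a. sup_dist n (fst (est a)) \<alpha>s + sup_dist n (fst (snd (est a))) \<beta>s > 2 * error_const B * h}
    \<le> 6 * n * exp (- ((n * h\<^sup>2)\<^sup>2 / (4 * n)))"
proof -
  define t where "t = n * h\<^sup>2"
  define out inn rec :: "nat \<Rightarrow> nat \<Rightarrow> bool \<Rightarrow> bool \<Rightarrow> real" where
    "out = (\<lambda>i j x y. ind x - mean_out (\<alpha>s i + \<beta>s j) (\<beta>s i + \<alpha>s j) \<rho>s)" and
    "inn = (\<lambda>i j x y. ind y - mean_out (\<beta>s i + \<alpha>s j) (\<alpha>s i + \<beta>s j) \<rho>s)" and
    "rec = (\<lambda>i j x y. ind x * ind y - mean_rec (\<alpha>s i + \<beta>s j) (\<beta>s i + \<alpha>s j) \<rho>s)"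
  define neg :: "(nat \<Rightarrow> nat \<Rightarrow> bool \<Rightarrow> bool \<Rightarrow> real) \<Rightarrow> _" where "neg f = (\<lambda>i j x y. - f i j x y)" for f
  \<comment> \<open>Row, column and reciprocity statistics with both signs, so that one-sided tail
    bounds control absolute values.\<close>
  define H where "H = set [out, inn, rec, neg out, neg inn, neg rec]"
  have centered: "dyad_centered \<alpha>s \<beta>s \<rho>s out" "dyad_centered \<alpha>s \<beta>s \<rho>s inn" "dyad_centered \<alpha>s \<beta>s \<rho>s rec"
    unfolding out_def inn_def rec_def by (rule dyad_centered_out dyad_centered_in dyad_centered_rec)+
  then have "dyad_centered \<alpha>s \<beta>s \<rho>s (neg f)" if "f \<in> {out, inn, rec}" for f
    using that unfolding neg_def by (auto intro: dyad_centered_uminus)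
  with centered have H: "finite H" "\<And>h. h \<in> H \<Longrightarrow> dyad_centered \<alpha>s \<beta>s \<rho>s h"
    by (auto simp: H_def)
  have cardH: "card H \<le> 6" unfolding H_def by (rule order_trans[OF card_length]) simp
  have tn: "0 \<le> t" "t \<le> 2 * n"
  proof -
    have "h\<^sup>2 \<le> 1" using h by (simp add: power_le_one)
    then show "0 \<le> t" "t \<le> 2 * n" using n by (simp_all add: t_def)
  qed
  have event: "\<exists>i\<in>{1..n}. \<exists>f\<in>H. t < (\<Sum>j\<in>{1..n} - {i}. f i j (a i j) (a j i))"
    if a: "a \<in> graphs n" and bad: "sup_dist n (fst (est a)) \<alpha>s + sup_dist n (fst (snd (est a))) \<beta>s > 2 * error_const B * h"
    for a
  proof (rule ccontr)
    assume "\<not> ?thesis"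
    then have le: "(\<Sum>j\<in>{1..n} - {i}. f i j (a i j) (a j i)) \<le> t" if "f \<in> H" "i \<in> {1..n}" for f i
      using that by (meson not_le)
    have abs_le: "\<bar>\<Sum>j\<in>{1..n} - {i}. f i j (a i j) (a j i)\<bar> \<le> t" if "f \<in> {out, inn, rec}" "i \<in> {1..n}" for f i
    proof -
      have "f \<in> H" "neg f \<in> H" using that(1) by (auto simp: H_def)
      from le[OF this(1) that(2)] le[OF this(2) that(2)] show ?thesis by (simp add: neg_def sum_negf)
    qed
    obtain \<alpha>h \<beta>h \<rho>h where e: "est a = (\<alpha>h, \<beta>h, \<rho>h)" by (cases "est a") auto
    interpret mle_concentrated n B a \<alpha>s \<beta>s \<rho>s \<alpha>h \<beta>h \<rho>h t
    proof
      show "(\<alpha>h, \<beta>h, \<rho>h) \<in> param_space n B" using est_mle[OF a] e by simp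
      show "loglik n a \<alpha> \<beta> \<rho> \<le> loglik n a \<alpha>h \<beta>h \<rho>h" if "(\<alpha>, \<beta>, \<rho>) \<in> param_space n B" for \<alpha> \<beta> \<rho>
        using est_mle[OF a] e that by auto
      fix i assume i: "i \<in> {1..n}"
      show "\<bar>\<Sum>j\<in>{1..n} - {i}. noise_out \<alpha>s \<beta>s \<rho>s a i j\<bar> \<le> t"
        using abs_le[of out, OF _ i] by (simp add: out_def noise_out_def)
      show "\<bar>\<Sum>j\<in>{1..n} - {i}. noise_out \<alpha>s \<beta>s \<rho>s a j i\<bar> \<le> t"
        using abs_le[of inn, OF _ i] by (simp add: inn_def noise_out_def add.commute)
      show "\<bar>\<Sum>j\<in>{1..n} - {i}. noise_rec \<alpha>s \<beta>s \<rho>s a i j\<bar> \<le> t"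
        using abs_le[of rec, OF _ i] by (simp add: rec_def noise_rec_def)
    qed (use n B_pos true_in in auto)
    have err: "\<bar>\<alpha>h i - \<alpha>s i\<bar> + \<bar>\<beta>h i - \<beta>s i\<bar> \<le> error_const B * h" if "i \<in> {1..n}" for i
      by (rule error_bound) (use h that in \<open>auto simp: t_def\<close>)
    have "sup_dist n \<alpha>h \<alpha>s \<le> error_const B * h"
      unfolding sup_dist_def by (subst Max_le_iff) (use n in \<open>auto dest!: err[simplified]\<close>)
    moreover have "sup_dist n \<beta>h \<beta>s \<le> error_const B * h"
      unfolding sup_dist_def by (subst Max_le_iff) (use n in \<open>auto dest!: err[simplified]\<close>)
    ultimately show False using bad e by simp
  qed
  have "model_prob n \<alpha>s \<beta>s \<rho>s
      {a. sup_dist n (fst (est a)) \<alpha>s + sup_dist n (fst (snd (est a))) \<beta>s > 2 * error_const B * h}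
    \<le> card H * n * exp (- (t\<^sup>2 / (4 * n)))"
  proof -
    have "0 < n" using n by simp
    from model_prob_union_bound[OF tn this H, where S = "{a. sup_dist n (fst (est a)) \<alpha>s + sup_dist n (fst (snd (est a))) \<beta>s > 2 * error_const B * h}"]
    show ?thesis using event by simp
  qed
  also have "\<dots> \<le> 6 * n * exp (- (t\<^sup>2 / (4 * n)))"
  proof -
    have "real (card H) * real n \<le> 6 * real n" using cardH by (intro mult_right_mono) simp_all
    then show ?thesis by (simp add: mult_right_mono)
  qed
  finally show ?thesis by (simp add: t_def)
qed

theorem theorem2:
  fixes B :: real
    and \<alpha>s \<beta>s :: "nat \<Rightarrow> nat \<Rightarrow> real"
    and \<rho>s :: "nat \<Rightarrow> real"
    and est :: "nat \<Rightarrow> (nat \<Rightarrow> nat \<Rightarrow> bool) \<Rightarrow> (nat \<Rightarrow> real) \<times> (nat \<Rightarrow> real) \<times> real"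
  assumes B_pos: "B > 0"
    and true_in: "\<And>n. (\<alpha>s n, \<beta>s n, \<rho>s n) \<in> param_space n B"
    and est_mle: "\<And>n a. a \<in> graphs n \<Longrightarrow>
         est n a \<in> param_space n B \<and>
         (\<forall>(\<alpha>, \<beta>, \<rho>) \<in> param_space n B.
            loglik n a \<alpha> \<beta> \<rho> \<le> loglik n a (fst (est n a)) (fst (snd (est n a))) (snd (snd (est n a))))"
  shows "\<forall>\<epsilon>>0. \<exists>M N. \<forall>n\<ge>N.
           model_prob n (\<alpha>s n) (\<beta>s n) (\<rho>s n)
             {a. sup_dist n (fst (est n a)) (\<alpha>s n) + sup_dist n (fst (snd (est n a))) (\<beta>s n)
                   > M * (real n powr (-1/8) * sqrt (ln (real n)))} < \<epsilon>"
proof (intro allI impI)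
  fix \<epsilon> :: real
  assume "\<epsilon> > 0"
  \<comment> \<open>Here \<open>n * h^2\<close> is \<open>n powr (3/4) * ln n\<close>, so the
    exponent in the tail bound is of order \<open>sqrt n * (ln n)^2\<close> and beats the factor
    \<open>6 * n\<close>. The constant \<open>M = 2 * error_const B\<close> serves every
    \<open>\<epsilon>\<close>.\<close>
  define h where "h n = real n powr (-1/8) * sqrt (ln (real n))" for n :: nat
  have "eventually (\<lambda>n. 2 \<le> n) sequentially" by (rule eventually_ge_at_top)
  moreover have "eventually (\<lambda>n. 0 < h n) sequentially" unfolding h_def by real_asymp
  moreover have "eventually (\<lambda>n. h n \<le> 1) sequentially" unfolding h_def by real_asymp
  moreover have "eventually (\<lambda>n. 1 \<le> n * (h n)\<^sup>2) sequentially" unfolding h_def by real_asymp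
  moreover have "(\<lambda>n. 6 * n * exp (- ((n * (h n)\<^sup>2)\<^sup>2 / (4 * n)))) \<longlonglongrightarrow> 0"
    unfolding h_def by real_asymp
  from order_tendstoD(2)[OF this \<open>\<epsilon> > 0\<close>]
  have "eventually (\<lambda>n. 6 * n * exp (- ((n * (h n)\<^sup>2)\<^sup>2 / (4 * n))) < \<epsilon>) sequentially" .
  ultimately have "eventually (\<lambda>n. model_prob n (\<alpha>s n) (\<beta>s n) (\<rho>s n)
     {a. sup_dist n (fst (est n a)) (\<alpha>s n) + sup_dist n (fst (snd (est n a))) (\<beta>s n)
           > 2 * error_const B * h n} < \<epsilon>) sequentially"
  proof eventually_elim
    case (elim n)
    show ?case
      using model_prob_error_le[OF B_pos elim(1) true_in est_mle elim(2-4)] elim(5) by simp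
  qed
  then show "\<exists>M N. \<forall>n\<ge>N.
           model_prob n (\<alpha>s n) (\<beta>s n) (\<rho>s n)
             {a. sup_dist n (fst (est n a)) (\<alpha>s n) + sup_dist n (fst (snd (est n a))) (\<beta>s n)
                   > M * (real n powr (-1/8) * sqrt (ln (real n)))} < \<epsilon>"
    unfolding eventually_sequentially h_def by blast
qed

end
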